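(* For every string $S$ of length $n$ whose maximum character frequency is $m$, there exists a data structure of ${\rm O}(nm+n\log n)$ bits, in addition to $S$, that answers range mode enumeration queries. A query range $[l,r]$ with $0\le l\le r<n$ is answered in ${\rm O}(\log m+|output|)$ time.
   Context: $S=S[0..n-1]$ is a string over an alphabet $\Sigma$. There is a bijection $\Sigma\to\{0,\dots,|\Sigma|-1\}$ computable in constant time. A mode of a non-empty multiset is an element whose multiplicity is at least that of every other element. The range mode enumeration query for $[l,r]$ asks for all distinct characters that are modes of the multiset $\{S[l],\dots,S[r]\}$. $|output|$ is the number of such characters. $m$ is the largest number of occurrences of any character in $S$. Space is counted in bits and excludes the input string $S$, which may be accessed during queries. *)

theory Defs
  imports Complex_Main "HOL-Library.Multiset"
begin

definition is_mode :: "'a multiset \<Rightarrow> 'a \<Rightarrow> bool" where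
  "is_mode M c \<longleftrightarrow> c \<in># M \<and> (\<forall>d. d \<in># M \<longrightarrow> count M d \<le> count M c)"

definition range_mset :: "'a list \<Rightarrow> nat \<Rightarrow> nat \<Rightarrow> 'a multiset" where
  "range_mset S l r = {# S ! i. i \<in># mset_set {l..r} #}"

definition range_modes :: "'a list \<Rightarrow> nat \<Rightarrow> nat \<Rightarrow> 'a set" where
  "range_modes S l r = {c. is_mode (range_mset S l r) c}"

text \<open>The 0 only serves to give the empty string the value 0.\<close>

definition max_freq :: "'a list \<Rightarrow> nat" where
  "max_freq S = Max (insert 0 (count_list S ` set S))"

text \<open>
  Queries run on a word RAM with \<open>w\<close>-bit words, programmed in a small structured language.
  Words are natural numbers below \<open>2 ^ w\<close>, and every operation truncates its result to \<open>w\<close> bits.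
  A program has read-only access to the input string (\<open>Text\<close>, one character code per unit-cost
  access; \<open>TextLen\<close> is its length), read-only access to the bits of the data structure, packed
  into words of \<open>w\<close> bits (\<open>Data\<close>), and read/write access to registers and to scratch memory
  (\<open>Mem\<close>, \<open>Store\<close>). Reading \<open>Text\<close> or \<open>Data\<close> beyond the end yields 0.
\<close>

datatype binop =
  ADD | SUB | MUL | DIV | AND | OR | XOR | SHL | SHR | EQ | LT

datatype expr =
    Const nat
  | Reg nat
  | WordSize
  | TextLen
  | Text expr
  | Data expr
  | Mem expr
  | Bin binop expr expr

datatype com =
    Skip
  | Assign nat expr
  | Store expr expr
  | Emit expr
  | Seq com com
  | If expr com com
  | While expr com

record state =
  regs :: "nat \<Rightarrow> nat"
  mem :: "nat \<Rightarrow> nat"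
  out :: "nat list"

text \<open>
  Operations on arguments below \<open>2 ^ w\<close>: subtraction wraps around, division by 0 yields 0, and
  comparisons yield 1 for true and 0 for false.
\<close>

fun apply_binop :: "nat \<Rightarrow> binop \<Rightarrow> nat \<Rightarrow> nat \<Rightarrow> nat" where
  "apply_binop w ADD a b = (a + b) mod 2 ^ w"
| "apply_binop w SUB a b = (a + 2 ^ w - b) mod 2 ^ w"
| "apply_binop w MUL a b = (a * b) mod 2 ^ w"
| "apply_binop w DIV a b = (a div b) mod 2 ^ w"
| "apply_binop w AND a b = (Bit_Operations.and a b) mod 2 ^ w"
| "apply_binop w OR a b = (Bit_Operations.or a b) mod 2 ^ w"
| "apply_binop w XOR a b = (Bit_Operations.xor a b) mod 2 ^ w"
| "apply_binop w SHL a b = push_bit b a mod 2 ^ w"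
| "apply_binop w SHR a b = drop_bit b a mod 2 ^ w"
| "apply_binop w EQ a b = of_bool (a = b) mod 2 ^ w"
| "apply_binop w LT a b = of_bool (a < b) mod 2 ^ w"

text \<open>Word number \<open>j\<close> of a bit string, least significant bit first.\<close>

definition data_word :: "nat \<Rightarrow> bool list \<Rightarrow> nat \<Rightarrow> nat" where
  "data_word w D j = horner_sum of_bool 2 (take w (drop (j * w) D))"

definition text_word :: "nat \<Rightarrow> nat list \<Rightarrow> nat \<Rightarrow> nat" where
  "text_word w T i = (if i < length T then T ! i else 0) mod 2 ^ w"

fun eval :: "nat \<Rightarrow> nat list \<Rightarrow> bool list \<Rightarrow> state \<Rightarrow> expr \<Rightarrow> nat" where
  "eval w T D s (Const k) = k mod 2 ^ w"
| "eval w T D s (Reg x) = regs s x"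
| "eval w T D s WordSize = w mod 2 ^ w"
| "eval w T D s TextLen = length T mod 2 ^ w"
| "eval w T D s (Text e) = text_word w T (eval w T D s e)"
| "eval w T D s (Data e) = data_word w D (eval w T D s e)"
| "eval w T D s (Mem e) = mem s (eval w T D s e)"
| "eval w T D s (Bin f e1 e2) = apply_binop w f (eval w T D s e1) (eval w T D s e2)"

fun cost :: "expr \<Rightarrow> nat" where
  "cost (Const k) = 1"
| "cost (Reg x) = 1"
| "cost WordSize = 1"
| "cost TextLen = 1"
| "cost (Text e) = 1 + cost e"
| "cost (Data e) = 1 + cost e"
| "cost (Mem e) = 1 + cost e"
| "cost (Bin f e1 e2) = 1 + cost e1 + cost e2"

text \<open>\<open>exec w T D c s t s'\<close>: started in \<open>s\<close>, command \<open>c\<close> halts in \<open>s'\<close> after \<open>t\<close> time steps.\<close>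

inductive exec ::
  "nat \<Rightarrow> nat list \<Rightarrow> bool list \<Rightarrow> com \<Rightarrow> state \<Rightarrow> nat \<Rightarrow> state \<Rightarrow> bool"
  for w :: nat and T :: "nat list" and D :: "bool list" where
  Skip: "exec w T D Skip s 1 s"
| Assign: "exec w T D (Assign x e) s (1 + cost e)
    (s\<lparr>regs := (regs s)(x := eval w T D s e)\<rparr>)"
| Store: "exec w T D (Store a e) s (1 + cost a + cost e)
    (s\<lparr>mem := (mem s)(eval w T D s a := eval w T D s e)\<rparr>)"
| Emit: "exec w T D (Emit e) s (1 + cost e) (s\<lparr>out := out s @ [eval w T D s e]\<rparr>)"
| Seq: "exec w T D c1 s t1 s1 \<Longrightarrow> exec w T D c2 s1 t2 s2 \<Longrightarrow>
    exec w T D (Seq c1 c2) s (t1 + t2) s2"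
| IfTrue: "eval w T D s b \<noteq> 0 \<Longrightarrow> exec w T D c1 s t s1 \<Longrightarrow>
    exec w T D (If b c1 c2) s (1 + cost b + t) s1"
| IfFalse: "eval w T D s b = 0 \<Longrightarrow> exec w T D c2 s t s1 \<Longrightarrow>
    exec w T D (If b c1 c2) s (1 + cost b + t) s1"
| WhileFalse: "eval w T D s b = 0 \<Longrightarrow> exec w T D (While b c) s (1 + cost b) s"
| WhileTrue: "eval w T D s b \<noteq> 0 \<Longrightarrow> exec w T D c s t1 s1 \<Longrightarrow>
    exec w T D (While b c) s1 t2 s2 \<Longrightarrow>
    exec w T D (While b c) s (1 + cost b + t1 + t2) s2"

lemma exec_deterministic:
  assumes "exec w T D c s t s1" and "exec w T D c s t' s2"
  shows "t = t' \<and> s1 = s2"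
  using assms
proof (induction arbitrary: t' s2 rule: exec.induct)
  case (Skip s) then show ?case by (auto elim: exec.cases)
next
  case (Assign x e s) then show ?case by (auto elim: exec.cases)
next
  case (Store a e s) then show ?case by (auto elim: exec.cases)
next
  case (Emit e s) then show ?case by (auto elim: exec.cases)
next
  case (Seq c1 s t1 s1 c2 t2 s2)
  from Seq.prems show ?case by (cases rule: exec.cases) (use Seq.IH in blast)+
next
  case (IfTrue s b c1 t s1 c2)
  from IfTrue.prems show ?case
    by (cases rule: exec.cases) (use IfTrue.IH IfTrue.hyps in blast)+
next
  case (IfFalse s b c2 t s1 c1)
  from IfFalse.prems show ?case
    by (cases rule: exec.cases) (use IfFalse.IH IfFalse.hyps in blast)+
next
  case (WhileFalse s b c)
  from WhileFalse.prems show ?case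
    by (cases rule: exec.cases) (use WhileFalse.hyps in blast)+
next
  case (WhileTrue s b c t1 s1 t2 s2)
  from WhileTrue.prems show ?case
    by (cases rule: exec.cases) (use WhileTrue.IH WhileTrue.hyps in blast)+
qed

text \<open>
  The initial state of a query: the range is in registers 0 and 1 and nothing has been output.
  All other registers and the scratch memory hold arbitrary words, so that nothing but the
  data structure is carried over to a query.
\<close>

definition query_start :: "nat \<Rightarrow> nat \<Rightarrow> nat \<Rightarrow> state \<Rightarrow> bool" where
  "query_start w l r s \<longleftrightarrow>
     regs s 0 = l \<and> regs s 1 = r \<and> out s = [] \<and>
     (\<forall>x. regs s x < 2 ^ w) \<and> (\<forall>a. mem s a < 2 ^ w)"

text \<open>
  \<open>D\<close> answers the query \<open>[l, r]\<close> on \<open>S\<close> within \<open>\<tau>\<close> steps: program \<open>Q\<close> emits the code of every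
  mode of the range exactly once, in any order, and nothing else.
\<close>

definition answers_query ::
  "com \<Rightarrow> nat \<Rightarrow> ('a \<Rightarrow> nat) \<Rightarrow> 'a list \<Rightarrow> bool list \<Rightarrow> nat \<Rightarrow> nat \<Rightarrow> real \<Rightarrow> bool" where
  "answers_query Q w code S D l r \<tau> \<longleftrightarrow>
     (\<forall>s. query_start w l r s \<longrightarrow>
        (\<exists>t s'. exec w (map code S) D Q s t s' \<and>
           distinct (out s') \<and> set (out s') = code ` range_modes S l r \<and> real t \<le> \<tau>))"

end

theory Submission
  imports Defs "HOL-Library.Discrete_Functions"
begin

text \<open>
  For a frequency \<open>k\<close> let \<open>pos k i\<close> be the end of the shortest range that starts at \<open>i\<close> and contains
  \<open>S ! i\<close> \<open>k\<close> times (\<open>n\<close> if there is none). Some character occurs \<open>k\<close> times in \<open>[l, r]\<close> iff the minimum of \<open>pos k\<close> over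
  \<open>[l, r]\<close> is at most \<open>r\<close>, so binary search with range minima finds the frequency \<open>k\<close> of the modes
  with \<open>O(log m)\<close> range minima. Since no character occurs \<open>k + 1\<close> times, every mode is \<open>S ! i\<close> for
  exactly one \<open>i\<close> in the range with \<open>pos k i \<le> r\<close>. These \<open>i\<close> are enumerated by splitting the range
  at its minimum until the minimum exceeds \<open>r\<close>, which takes \<open>O(|output|)\<close> range minima. It remains
  to answer range minima over \<open>pos k\<close> in constant time with \<open>O(n)\<close> bits for each \<open>k\<close>, apart from
  \<open>O(n log n)\<close> bits that are shared by all \<open>k\<close>.
\<close>

section \<open>Range minima from tree shapes\<close>

text \<open>Only O(n) bits are available per frequency, while a single value of
  \<open>kth_occ\<close> needs about log n bits, so the values cannot be stored. Inside a block of s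
  positions the shape of a Cartesian tree determines an argmin of every subrange and takes 2 s + 1
  bits. With s about a quarter of \<open>b\<close>, the 2 ^ (2 s + 1) codes times (s + 1) ^ 2 pairs
  of bounds fit into 2 ^ b = O(n) table entries. For ranges of whole blocks, a sparse table over n /
  s blocks would have (n / s) b entries of b bits, still of order n log n for each frequency. Hence
  blocks are grouped once more: over n / s ^ 2 superblocks such a table takes O(n) bits. Candidates
  from different parts must be compared by value; equal characters are contiguous in the sorted
  order, so a value is recomputed by moving k - 1 places there. The program is fixed while
  \<open>b\<close> grows with n, so the layout has to be recovered by word arithmetic at query
  time.\<close>

definition range_argmin :: "(nat \<Rightarrow> nat) \<Rightarrow> nat \<Rightarrow> nat \<Rightarrow> nat \<Rightarrow> bool" where
  "range_argmin f a b p \<longleftrightarrow> a \<le> p \<and> p < b \<and> (\<forall>i\<in>{a..<b}. f p \<le> f i)"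

lemma range_argmin_exists: "a < b \<Longrightarrow> \<exists>p. range_argmin f a b p"
proof -
  assume "a < b"
  then have "f ` {a..<b} \<noteq> {}" "finite (f ` {a..<b})" by auto
  then obtain p where "p \<in> {a..<b}" "f p = Min (f ` {a..<b})"
    by (metis (no_types, lifting) Min_in imageE)
  then show ?thesis unfolding range_argmin_def by (intro exI[of _ p]) auto
qed

text \<open>The two ranges may overlap, since a minimum is unaffected by positions that are counted
  twice. Sparse tables rely on this.\<close>

lemma range_argmin_union:
  assumes "range_argmin f a b p" "range_argmin f c d q" "a \<le> c" "c \<le> b" "b \<le> d"
  shows "range_argmin f a d (if f q < f p then q else p)"
proof -
  define v where "v = min (f p) (f q)"
  have "v \<le> f i" if "i \<in> {a..<d}" for i
  proof (cases "i < b")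
    case True
    then have "f p \<le> f i" using that assms(1) by (auto simp: range_argmin_def)
    then show ?thesis by (simp add: v_def)
  next
    case False
    then have "f q \<le> f i" using that assms(2,4) by (auto simp: range_argmin_def)
    then show ?thesis by (simp add: v_def)
  qed
  then show ?thesis using assms by (auto simp: range_argmin_def v_def)
qed

text \<open>\<open>g y\<close> represents block \<open>y\<close> of length \<open>u\<close>.
  Position \<open>i\<close> is dominated by the representative of block \<open>i div u\<close>, so a
  best representative is a minimum of the whole union.\<close>

lemma range_argmin_blocks:
  assumes "\<And>y. a \<le> y \<Longrightarrow> y < b \<Longrightarrow> range_argmin f (y * u) ((y + 1) * u) (g y)"
    and "range_argmin (\<lambda>y. f (g y)) a b y"
  shows "range_argmin f (a * u) (b * u) (g y)"
proof -
  have y: "a \<le> y" "y < b" "\<And>z. a \<le> z \<Longrightarrow> z < b \<Longrightarrow> f (g y) \<le> f (g z)"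
    using assms(2) by (auto simp: range_argmin_def)
  have g: "y * u \<le> g y" "g y < (y + 1) * u"
    using assms(1)[of y] y by (auto simp: range_argmin_def)
  have "f (g y) \<le> f i" if i: "a * u \<le> i" "i < b * u" for i
  proof -
    have u: "u > 0" using g by (cases u) auto
    have z: "a \<le> i div u" "i div u < b"
      using i u by (auto simp: less_eq_div_iff_mult_less_eq div_less_iff_less_mult)
    have "i \<in> {i div u * u..<(i div u + 1) * u}"
      using u by (simp add: div_times_less_eq_dividend dividend_less_div_times)
    then have "f (g (i div u)) \<le> f i"
      using assms(1)[OF z] by (simp add: range_argmin_def)
    then show ?thesis using y(3)[OF z] by simp
  qed
  moreover have "a * u \<le> g y" by (rule le_trans[OF mult_le_mono1[OF y(1)] g(1)])
  moreover have "g y < b * u"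
    by (rule less_le_trans[OF g(2) mult_le_mono1]) (use y(2) in simp)
  ultimately show ?thesis by (simp add: range_argmin_def)
qed

datatype shape = Tip | Node shape shape

fun nodes :: "shape \<Rightarrow> nat" where
  "nodes Tip = 0"
| "nodes (Node l r) = nodes l + 1 + nodes r"

text \<open>The least common ancestor of the inorder positions \<open>a, \<dots>, b - 1\<close>.\<close>

fun pick :: "shape \<Rightarrow> nat \<Rightarrow> nat \<Rightarrow> nat" where
  "pick Tip a b = 0"
| "pick (Node l r) a b =
     (if b \<le> nodes l then pick l a b
      else if nodes l < a then nodes l + 1 + pick r (a - (nodes l + 1)) (b - (nodes l + 1))
      else nodes l)"

text \<open>A minimum becomes the root and both sides are treated recursively. A range on one side
  of the root is answered in that subtree; a range containing the root position is answered by the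
  root.\<close>

lemma cartesian_shape_exists:
  "\<exists>t. nodes t = s \<and> (\<forall>a b. a < b \<and> b \<le> s \<longrightarrow> range_argmin f (x + a) (x + b) (x + pick t a b))"
proof (induction s arbitrary: x rule: less_induct)
  case (less s)
  show ?case
  proof (cases "s = 0")
    case True
    then show ?thesis by (intro exI[of _ Tip]) auto
  next
    case False
    then obtain q where q: "range_argmin f x (x + s) q" using range_argmin_exists[of x "x + s" f] by auto
    define p where "p = q - x"
    have p: "q = x + p" "p < s" and min: "\<And>i. x \<le> i \<Longrightarrow> i < x + s \<Longrightarrow> f (x + p) \<le> f i"
      using q by (auto simp: p_def range_argmin_def)
    obtain l where l: "nodes l = p"
      "\<And>a b. a < b \<Longrightarrow> b \<le> p \<Longrightarrow> range_argmin f (x + a) (x + b) (x + pick l a b)"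
      using less[of p x] p by blast
    obtain r where r: "nodes r = s - (p + 1)"
      "\<And>a b. a < b \<Longrightarrow> b \<le> s - (p + 1) \<Longrightarrow>
        range_argmin f (x + (p + 1) + a) (x + (p + 1) + b) (x + (p + 1) + pick r a b)"
      using less[of "s - (p + 1)" "x + (p + 1)"] p by auto
    have "range_argmin f (x + a) (x + b) (x + pick (Node l r) a b)" if ab: "a < b" "b \<le> s" for a b
    proof -
      consider "b \<le> p" | "b > p" "p < a" | "b > p" "a \<le> p" by linarith
      then show ?thesis
      proof cases
        case 1 then show ?thesis using l ab by auto
      next
        case 2
        then have "range_argmin f (x + (p + 1) + (a - (p + 1))) (x + (p + 1) + (b - (p + 1)))
            (x + (p + 1) + pick r (a - (p + 1)) (b - (p + 1)))"
          using ab by (intro r(2)) auto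
        moreover have "x + (p + 1) + (a - (p + 1)) = x + a" "x + (p + 1) + (b - (p + 1)) = x + b"
          using 2 by auto
        moreover have "pick (Node l r) a b = p + 1 + pick r (a - (p + 1)) (b - (p + 1))"
          using 2 l(1) by simp
        ultimately show ?thesis by (simp only: add.assoc)
      next
        case 3
        then show ?thesis using l(1) ab min by (auto simp: range_argmin_def)
      qed
    qed
    moreover have "nodes (Node l r) = s" using l r p by auto
    ultimately show ?thesis by blast
  qed
qed

text \<open>Preorder, one bit per inner node and per leaf; there is one leaf more than there are
  inner nodes.\<close>

fun shape_bits :: "shape \<Rightarrow> bool list" where
  "shape_bits Tip = [False]"
| "shape_bits (Node l r) = True # shape_bits l @ shape_bits r"

lemma length_shape_bits: "length (shape_bits t) = 2 * nodes t + 1"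
  by (induction t) auto

text \<open>The arbitrary tails carry the induction: cancelling the left subtree leaves the right
  subtree followed by the old tail.\<close>

lemma shape_bits_prefix_free: "shape_bits t @ x = shape_bits u @ y \<Longrightarrow> t = u \<and> x = y"
proof (induction t arbitrary: u x y)
  case Tip then show ?case by (cases u) auto
next
  case (Node l r)
  from Node.prems obtain l' r' where u: "u = Node l' r'" by (cases u) auto
  with Node.prems have "shape_bits l @ (shape_bits r @ x) = shape_bits l' @ (shape_bits r' @ y)" by simp
  then have l: "l = l' \<and> shape_bits r @ x = shape_bits r' @ y" by (rule Node.IH(1))
  from l[THEN conjunct2] have r: "r = r' \<and> x = y" by (rule Node.IH(2))
  show ?case using conjunct1[OF l] r u by simp
qed

definition shape_code :: "shape \<Rightarrow> nat" where
  "shape_code t = horner_sum of_bool 2 (shape_bits t)"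

lemma shape_code_less: "shape_code t < 2 ^ (2 * nodes t + 1)"
proof -
  have "take_bit (2 * nodes t + 1) (shape_code t) = shape_code t"
    unfolding shape_code_def by (subst take_bit_horner_sum_bit_eq) (simp add: length_shape_bits)
  then show ?thesis by (simp only: take_bit_nat_eq_self_iff)
qed

text \<open>A number forgets its leading zeros, and every preorder ends in one. Fixing the number of
  nodes fixes the length and so restores the bits.\<close>

lemma inj_on_shape_code: "inj_on shape_code {t. nodes t = s}"
proof (rule inj_onI, clarify)
  fix t u assume a: "shape_code t = shape_code u" "nodes u = nodes t"
  then have len: "length (shape_bits t) = length (shape_bits u)" by (simp add: length_shape_bits)
  have bits: "i < length (shape_bits t) \<Longrightarrow> bit (shape_code t) i = shape_bits t ! i" for t i
    by (simp add: shape_code_def bit_horner_sum_bit_iff)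
  have "shape_bits t = shape_bits u"
    by (rule nth_equalityI) (simp_all add: len bits[of _ t, symmetric] bits[of _ u, symmetric] a(1))
  then show "t = u" using shape_bits_prefix_free[of t "[]" u "[]"] by simp
qed

definition block_pick :: "nat \<Rightarrow> nat \<Rightarrow> nat \<Rightarrow> nat \<Rightarrow> nat" where
  "block_pick s c a b = pick (inv_into {t. nodes t = s} shape_code c) a b"

text \<open>All blocks with the same code share the entries of one global table of \<open>block_pick\<close>; this is
  why a block of length \<open>s\<close> costs only \<open>O(s)\<close> bits of its own.\<close>

lemma block_code_exists:
  "\<exists>c < 2 ^ (2 * s + 1).
     \<forall>a b. a < b \<and> b \<le> s \<longrightarrow> range_argmin f (x + a) (x + b) (x + block_pick s c a b)"
proof -
  obtain t where t: "nodes t = s"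
    "\<forall>a b. a < b \<and> b \<le> s \<longrightarrow> range_argmin f (x + a) (x + b) (x + pick t a b)"
    using cartesian_shape_exists by blast
  have "inv_into {t. nodes t = s} shape_code (shape_code t) = t"
    using t(1) by (intro inv_into_f_f inj_on_shape_code) auto
  then show ?thesis
    using t shape_code_less[of t] by (intro exI[of _ "shape_code t"]) (auto simp: block_pick_def)
qed

section \<open>Expressions\<close>

text \<open>Queries to the data structure are compiled to single expressions. Duplicating
  subexpressions is harmless, since the size of the program is a constant.\<close>

definition if_expr :: "expr \<Rightarrow> expr \<Rightarrow> expr \<Rightarrow> expr" where
  "if_expr c x y = Bin ADD (Bin MUL c x) (Bin MUL (Bin SUB (Const 1) c) y)"

definition mod_expr :: "expr \<Rightarrow> expr \<Rightarrow> expr" where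
  "mod_expr x y = Bin SUB x (Bin MUL (Bin DIV x y) y)"

definition mask_expr :: "expr \<Rightarrow> expr" where
  "mask_expr k = Bin SUB (Bin SHL (Const 1) k) (Const 1)"

definition read_expr :: "expr \<Rightarrow> expr \<Rightarrow> expr" where
  "read_expr p b =
     (let j = Bin DIV p WordSize; k = mod_expr p WordSize in
      Bin AND (Bin OR (Bin SHR (Data j) k)
        (Bin SHL (Data (Bin ADD j (Const 1))) (Bin SUB WordSize k))) (mask_expr b))"

definition wf_state :: "nat \<Rightarrow> state \<Rightarrow> bool" where
  "wf_state w st \<longleftrightarrow> (\<forall>x. regs st x < 2 ^ w) \<and> (\<forall>a. mem st a < 2 ^ w)"

lemma bit_data_word:
  "bit (data_word w D j) i \<longleftrightarrow> i < w \<and> j * w + i < length D \<and> D ! (j * w + i)"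
  by (auto simp: data_word_def bit_horner_sum_bit_iff)

lemma data_word_less: "data_word w D j < 2 ^ w"
proof -
  have "take_bit w (data_word w D j) = data_word w D j"
    unfolding data_word_def by (subst take_bit_horner_sum_bit_eq) simp
  then show ?thesis by (simp only: take_bit_nat_eq_self_iff)
qed

lemma apply_binop_less: "apply_binop w f a b < 2 ^ w"
  by (cases f) simp_all

lemma eval_less: "wf_state w st \<Longrightarrow> eval w T D st e < 2 ^ w"
  by (induction e) (auto simp: wf_state_def data_word_less text_word_def apply_binop_less)

locale machine =
  fixes w :: nat and T :: "nat list" and D :: "bool list"
  assumes w_pos: "0 < w"
begin

abbreviation ev :: "state \<Rightarrow> expr \<Rightarrow> nat" where
  "ev \<equiv> eval w T D"

lemma one_less: "(1::nat) < 2 ^ w"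
  using w_pos by (intro one_less_power) auto

lemma w_less: "w < 2 ^ w"
  by simp

lemma ev_Const: "k < 2 ^ w \<Longrightarrow> ev st (Const k) = k"
  by simp

lemma ev_ADD: "ev st x = a \<Longrightarrow> ev st y = c \<Longrightarrow> a + c < 2 ^ w \<Longrightarrow> ev st (Bin ADD x y) = a + c"
  by simp

lemma ev_MUL: "ev st x = a \<Longrightarrow> ev st y = c \<Longrightarrow> a * c < 2 ^ w \<Longrightarrow> ev st (Bin MUL x y) = a * c"
  by simp

lemma ev_SUB:
  assumes "ev st x = a" "ev st y = c" "c \<le> a" "a < 2 ^ w"
  shows "ev st (Bin SUB x y) = a - c"
proof -
  have "ev st (Bin SUB x y) = (a + 2 ^ w - c) mod 2 ^ w" using assms by simp
  also have "a + 2 ^ w - c = (a - c) + 2 ^ w" using assms(3) by simp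
  also have "(a - c + 2 ^ w) mod 2 ^ w = a - c"
    using assms(4) by (simp add: less_imp_diff_less)
  finally show ?thesis .
qed

lemma ev_DIV: "ev st x = a \<Longrightarrow> ev st y = c \<Longrightarrow> a < 2 ^ w \<Longrightarrow> ev st (Bin DIV x y) = a div c"
  by (simp add: le_less_trans[OF div_le_dividend])

lemma ev_LT: "ev st (Bin LT x y) = of_bool (ev st x < ev st y)"
  using one_less by auto

lemma ev_EQ: "ev st (Bin EQ x y) = of_bool (ev st x = ev st y)"
  using one_less by auto

lemma ev_mod_expr:
  assumes "ev st x = a" "ev st y = c" "a < 2 ^ w"
  shows "ev st (mod_expr x y) = a mod c"
proof -
  have "a div c * c \<le> a" by simp
  then have "a div c * c < 2 ^ w" using assms(3) by linarith
  then have "ev st (mod_expr x y) = a - a div c * c"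
    unfolding mod_expr_def using assms by (intro ev_SUB ev_MUL ev_DIV) auto
  then show ?thesis by (simp add: modulo_nat_def)
qed

text \<open>Both branches are always evaluated, so the rejected one may be a lookup at a meaningless
  index; the factor 0 removes it. Well-formedness makes the selected value a word, which truncation
  leaves unchanged.\<close>

lemma ev_if_expr:
  assumes "wf_state w st" "ev st c = of_bool P"
  shows "ev st (if_expr c x y) = (if P then ev st x else ev st y)"
proof -
  have "ev st x < 2 ^ w" "ev st y < 2 ^ w" using assms(1) by (auto intro: eval_less)
  \<comment> \<open>For condition 0 the machine computes \<open>1 - 0\<close> as
    \<open>(1 + 2 ^ w) mod 2 ^ w\<close>.\<close>
  moreover have "Suc (2 ^ w) mod 2 ^ w = 1"
    using mod_add_self2[of "1 :: nat" "2 ^ w"] unfolding mod_less[OF one_less] by (simp only: plus_1_eq_Suc)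
  ultimately show ?thesis using assms(2) one_less w_pos by (simp add: if_expr_def)
qed

lemma ev_SHL_1:
  assumes "ev st k = j" "j < w"
  shows "ev st (Bin SHL (Const 1) k) = 2 ^ j"
  using assms one_less by (simp add: push_bit_eq_mult)

text \<open>For \<open>j \<ge> w\<close> the shifted bit leaves the word and \<open>0 - 1\<close>
  wraps around to all ones, again the right mask. This occurs for the header, whose width
  \<open>n + 6\<close> may exceed \<open>w\<close>.\<close>

lemma ev_mask_expr:
  assumes "ev st k = j"
  shows "ev st (mask_expr k) = mask (min j w)"
proof (cases "j < w")
  case True
  have "ev st (mask_expr k) = 2 ^ j - 1"
    unfolding mask_expr_def using assms True one_less
    by (intro ev_SUB ev_SHL_1) auto
  then show ?thesis using True by (simp add: mask_eq_exp_minus_1)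
next
  case False
  then have "(2::nat) ^ w dvd 2 ^ j" by (simp add: le_imp_power_dvd)
  then have "ev st (Bin SHL (Const 1) k) = 0"
    using assms one_less by (simp add: push_bit_eq_mult)
  then have "ev st (mask_expr k) = 2 ^ w - 1"
    using one_less by (simp add: mask_expr_def del: eval.simps(1)
        add: ev_Const)
  then show ?thesis using False by (simp add: mask_eq_exp_minus_1 min_def)
qed

text \<open>A field of at most \<open>w\<close> bits meets at most two consecutive words: the first
  is shifted down by \<open>r\<close>, the second up by \<open>w - r\<close>. For
  \<open>r = 0\<close> the second shift is by \<open>w\<close> and truncation erases it, so no case
  distinction is needed in the expression.\<close>

lemma bit_ev_read_expr:
  assumes P: "ev st p = k" "k + 1 < 2 ^ w" and B: "ev st b = c" "c \<le> w"
  shows "bit (ev st (read_expr p b)) i \<longleftrightarrow> i < c \<and> k + i < length D \<and> D ! (k + i)"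
proof -
  define j where "j = k div w"
  define r where "r = k mod w"
  have k: "k = j * w + r" "r < w" using w_pos by (simp_all add: j_def r_def)
  have W: "ev st WordSize = w" by simp
  have evj: "ev st (Bin DIV p WordSize) = j"
    unfolding j_def by (intro ev_DIV P W) (use P in simp)
  have "j \<le> k" by (simp add: j_def)
  then have evj1: "ev st (Bin ADD (Bin DIV p WordSize) (Const 1)) = j + 1"
    using P(2) one_less by (intro ev_ADD evj ev_Const) auto
  have evr: "ev st (mod_expr p WordSize) = r"
    unfolding r_def by (intro ev_mod_expr P W) (use P in simp)
  have evwr: "ev st (Bin SUB WordSize (mod_expr p WordSize)) = w - r"
    using k(2) w_less by (intro ev_SUB evr W) auto
  have splice: "ev st (Bin AND (Bin OR (Bin SHR (Data e1) e2) (Bin SHL (Data e3) e4)) e5) =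
      take_bit w (and (take_bit w (or (take_bit w (drop_bit (ev st e2) (data_word w D (ev st e1))))
        (take_bit w (push_bit (ev st e4) (data_word w D (ev st e3)))))) (ev st e5))" for e1 e2 e3 e4 e5
    by (simp add: take_bit_eq_mod)
  have x: "ev st (read_expr p b) =
      take_bit w (and (take_bit w (or (take_bit w (drop_bit r (data_word w D j)))
        (take_bit w (push_bit (w - r) (data_word w D (j + 1)))))) (mask (min c w)))"
    unfolding read_expr_def Let_def splice evj evj1 evr evwr ev_mask_expr[OF B(1)] ..
  have hi: "(j + 1) * w + (i - (w - r)) = k + i" if "w - r \<le> i"
    using that k by simp
  have "bit (ev st (read_expr p b)) i \<longleftrightarrow> i < c \<and>
      ((r + i < w \<and> k + i < length D \<and> D ! (k + i)) \<or>
       (w - r \<le> i \<and> k + i < length D \<and> D ! (k + i)))"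
  proof (cases "i < c")
    case True
    then have i: "i < w" using B(2) by simp
    have "bit (ev st (read_expr p b)) i \<longleftrightarrow> bit (data_word w D j) (r + i) \<or>
        (w - r \<le> i \<and> bit (data_word w D (j + 1)) (i - (w - r)))"
      unfolding x using True i
      by (simp add: bit_take_bit_iff bit_and_iff bit_or_iff bit_drop_bit_eq bit_push_bit_iff bit_mask_iff)
    moreover have "bit (data_word w D j) (r + i) \<longleftrightarrow> r + i < w \<and> k + i < length D \<and> D ! (k + i)"
      unfolding bit_data_word k(1) by (simp add: add.assoc)
    moreover have "w - r \<le> i \<Longrightarrow> bit (data_word w D (j + 1)) (i - (w - r)) \<longleftrightarrow>
        k + i < length D \<and> D ! (k + i)"
      unfolding bit_data_word using hi i k(2) by (simp only: less_imp_diff_less simp_thms)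
    ultimately show ?thesis using True by blast
  next
    case False
    then show ?thesis unfolding x
      by (simp add: bit_take_bit_iff bit_and_iff bit_mask_iff)
  qed
  then show ?thesis by linarith
qed

end

section \<open>Packed data\<close>

text \<open>The queries do not know the field width \<open>b\<close>, so it is stored in front. Its field is as
  wide as a number that the queries do know; the remaining fields have width \<open>b\<close>.\<close>

definition pack :: "nat \<Rightarrow> nat \<Rightarrow> nat \<Rightarrow> (nat \<Rightarrow> nat) \<Rightarrow> bool list" where
  "pack h b M F = map (\<lambda>p. if p < h then bit b p else bit (F ((p - h) div b)) ((p - h) mod b)) [0..<h + M * b]"

definition width_expr :: expr where
  "width_expr = Bin AND (Data (Const 0)) (mask_expr (Bin ADD TextLen (Const 6)))"

definition field_expr :: "expr \<Rightarrow> expr" where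
  "field_expr f = read_expr (Bin ADD (Bin ADD TextLen (Const 6)) (Bin MUL f width_expr)) width_expr"

text \<open>Field numbers have at most \<open>5 * b\<close> bits and bit addresses little more than
  \<open>6 * b\<close>, so words of \<open>10 * b\<close> bits exclude overflow.\<close>

locale packed = machine +
  fixes n b M :: nat and F :: "nat \<Rightarrow> nat"
  assumes T_len: "length T = n"
    and D_eq: "D = pack (n + 6) b M F"
    and b_pos: "0 < b" and b_le: "10 * b \<le> w" and b_less: "b < 2 ^ (n + 6)"
    and n_less: "n + 6 < 2 ^ b"
    and M_less: "M < 2 ^ (5 * b)"
    and F_less: "f < M \<Longrightarrow> F f < 2 ^ b"
begin

lemma pow_w: "j \<le> 10 * b \<Longrightarrow> (2::nat) ^ j \<le> 2 ^ w"
  using b_le by (intro power_increasing) auto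

lemma less_w: "x < 2 ^ b \<Longrightarrow> x < 2 ^ w" for x :: nat
  using pow_w[of b] by linarith

lemma length_D: "length D = n + 6 + M * b"
  by (simp add: D_eq pack_def)

lemma ev_n: "ev st TextLen = n"
  using T_len n_less less_w[of n] by simp

lemma ev_head: "ev st (Bin ADD TextLen (Const 6)) = n + 6"
  using less_w[OF n_less] by (intro ev_ADD ev_n ev_Const) auto

lemma ev_width: "ev st width_expr = b"
proof (rule bit_eqI)
  fix i
  have bw: "b < 2 ^ w" using less_w[of b] less_exp[of b] by simp
  have x: "ev st width_expr = take_bit w (and (data_word w D 0) (mask (min (n + 6) w)))"
    unfolding width_expr_def
    by (simp only: eval.simps(6,8) ev_mask_expr[OF ev_head] apply_binop.simps take_bit_eq_mod) simp
  \<comment> \<open>All bits of \<open>b\<close> lie below both the header width and the word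
    length, so cutting at the smaller of the two loses nothing.\<close>
  have b_bit: "bit b i \<Longrightarrow> i < n + 6" "bit b i \<Longrightarrow> i < w"
    using b_less bw by (metis bit_take_bit_iff take_bit_nat_eq_self)+
  have "bit (ev st width_expr) i \<longleftrightarrow> i < n + 6 \<and> i < w \<and> bit b i"
    unfolding x
    by (auto simp: bit_take_bit_iff bit_and_iff bit_mask_iff bit_data_word length_D)
       (auto simp: D_eq pack_def)
  then show "bit (ev st width_expr) i = bit b i" using b_bit by blast
qed

lemma ev_field_expr:
  assumes f: "ev st e = f" "f < M"
  shows "ev st (field_expr e) = F f"
proof (rule bit_eqI)
  fix i
  have "f * b < 2 ^ (5 * b) * 2 ^ b"
    using f(2) M_less less_exp[of b] by (intro mult_strict_mono) auto
  then have fb: "f * b < 2 ^ (6 * b)" by (simp flip: power_add)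
  have "(2::nat) ^ b \<le> 2 ^ (6 * b)" by (intro power_increasing) auto
  then have sum: "n + 6 + f * b + 1 < 2 ^ (6 * b) + 2 ^ (6 * b) + 1"
    using fb n_less by linarith
  have "(2::nat) ^ (6 * b) + 2 ^ (6 * b) + 1 \<le> 2 ^ (6 * b + 2)" by simp
  also have "\<dots> \<le> 2 ^ w" using b_pos by (intro pow_w) auto
  finally have less: "n + 6 + f * b + 1 < 2 ^ w" using sum by linarith
  have "ev st (Bin ADD (Bin ADD TextLen (Const 6)) (Bin MUL e width_expr)) = n + 6 + f * b"
    using less by (intro ev_ADD ev_MUL ev_head ev_width f(1)) auto
  then have bits: "bit (ev st (field_expr e)) i \<longleftrightarrow>
      i < b \<and> n + 6 + f * b + i < length D \<and> D ! (n + 6 + f * b + i)"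
    unfolding field_expr_def using less b_le by (intro bit_ev_read_expr ev_width) auto
  show "bit (ev st (field_expr e)) i = bit (F f) i"
  proof (cases "i < b")
    case True
    have "f * b + i < (f + 1) * b" using True by simp
    also have "\<dots> \<le> M * b" using f(2) by (intro mult_le_mono1) simp
    finally have "n + 6 + f * b + i < length D" by (simp add: length_D)
    moreover have "(f * b + i) div b = f" "(f * b + i) mod b = i" using True by simp_all
    ultimately show ?thesis unfolding bits using True
      by (simp add: D_eq pack_def)
  next
    case False
    have "\<not> bit (F f) i"
      using False F_less[OF f(2)] by (metis bit_take_bit_iff take_bit_nat_eq_self)
    then show ?thesis using bits False by simp
  qed
qed

end

section \<open>Occurrences and modes\<close>

definition occ :: "'a list \<Rightarrow> nat \<Rightarrow> nat \<Rightarrow> 'a \<Rightarrow> nat" where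
  "occ S a b c = card {i \<in> {a..<b}. S ! i = c}"

lemma occ_add: "a \<le> m \<Longrightarrow> m \<le> b \<Longrightarrow> occ S a b c = occ S a m c + occ S m b c"
  unfolding occ_def by (subst card_Un_disjoint[symmetric]) (auto intro!: arg_cong[where f = card])

lemma occ_Suc: "a \<le> b \<Longrightarrow> occ S a (Suc b) c = occ S a b c + of_bool (S ! b = c)"
proof -
  assume "a \<le> b"
  moreover have "{i \<in> {b..<Suc b}. S ! i = c} = (if S ! b = c then {b} else {})" by auto
  ultimately show ?thesis using occ_add[of a b "Suc b" S c] by (simp add: occ_def[of S b])
qed

lemma occ_first: "S ! a = c \<Longrightarrow> a < b \<Longrightarrow> 0 < occ S a b c"
  by (auto simp: occ_def card_gt_0_iff)

lemma occ_mono: "a \<le> a' \<Longrightarrow> b' \<le> b \<Longrightarrow> occ S a' b' c \<le> occ S a b c"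
  unfolding occ_def by (intro card_mono) auto

text \<open>The count grows by at most one per position, so it passes through \<open>k\<close> right
  before an occurrence. Counting starts at 0: \<open>k\<close> occurrences precede
  \<open>i\<close>.\<close>

lemma nth_occurrence_exists:
  "k < occ S a b c \<Longrightarrow> \<exists>i. a \<le> i \<and> i < b \<and> S ! i = c \<and> occ S a i c = k"
proof (induction b)
  case 0 then show ?case by (simp add: occ_def)
next
  case (Suc b)
  show ?case
  proof (cases "a \<le> b \<and> k = occ S a b c")
    case True
    then show ?thesis using Suc.prems by (auto simp: occ_Suc of_bool_def split: if_splits intro!: exI[of _ b])
  next
    case False
    have "a \<le> b" using Suc.prems by (rule contrapos_pp) (simp add: occ_def)
    then have "k < occ S a b c"
      using Suc.prems False by (auto simp: occ_Suc of_bool_def split: if_splits)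
    then show ?thesis using Suc.IH by (meson less_Suc_eq)
  qed
qed

lemma occ_le_max_freq:
  assumes "i < length S" "b \<le> length S"
  shows "occ S a b (S ! i) \<le> max_freq S"
proof -
  have "occ S a b (S ! i) \<le> count_list S (S ! i)"
    unfolding occ_def count_list_eq_length_filter length_filter_conv_card
    using assms by (intro card_mono) auto
  also have "\<dots> \<le> max_freq S"
    unfolding max_freq_def using assms by (intro Max_ge) auto
  finally show ?thesis .
qed

lemma max_freq_le_length: "max_freq S \<le> length S"
  unfolding max_freq_def by (auto simp: count_le_length)

text \<open>The rank of position \<open>i\<close> in a stable sort by character;
  \<open>sorted_at\<close> inverts this permutation.\<close>

definition sort_pos :: "('a \<Rightarrow> nat) \<Rightarrow> 'a list \<Rightarrow> nat \<Rightarrow> nat" where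
  "sort_pos code S i =
     card {j. j < length S \<and> (code (S ! j) < code (S ! i) \<or> S ! j = S ! i \<and> j < i)}"

definition sorted_at :: "('a \<Rightarrow> nat) \<Rightarrow> 'a list \<Rightarrow> nat \<Rightarrow> nat" where
  "sorted_at code S = inv_into {..<length S} (sort_pos code S)"

lemma sort_pos_less:
  assumes "i < length S" shows "sort_pos code S i < length S"
proof -
  have "sort_pos code S i \<le> card ({..<length S} - {i})"
    unfolding sort_pos_def by (intro card_mono) auto
  also have "\<dots> < length S" using assms by simp
  finally show ?thesis .
qed

text \<open>Of two positions, the earlier one in the sorted order has a strictly smaller set of
  predecessors; injectivity of \<open>code\<close> makes any two positions comparable.\<close>

lemma inj_on_sort_pos:
  assumes "inj_on code (set S)"
  shows "inj_on (sort_pos code S) {..<length S}"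
proof -
  have less: "sort_pos code S i < sort_pos code S i'"
    if "i < length S" "i' < length S" "code (S ! i) < code (S ! i') \<or> S ! i = S ! i' \<and> i < i'" for i i'
  proof -
    let ?f = "\<lambda>i. {j. j < length S \<and> (code (S ! j) < code (S ! i) \<or> S ! j = S ! i \<and> j < i)}"
    have "?f i \<subseteq> ?f i'" using that by auto
    moreover have "i \<in> ?f i'" "i \<notin> ?f i" using that by auto
    ultimately show ?thesis unfolding sort_pos_def by (intro psubset_card_mono) auto
  qed
  show ?thesis
  proof (rule inj_onI)
    fix i i' assume i: "i \<in> {..<length S}" "i' \<in> {..<length S}" "sort_pos code S i = sort_pos code S i'"
    have "code (S ! i) = code (S ! i')"
      using less[of i i'] less[of i' i] i by (cases "code (S ! i)" "code (S ! i')" rule: linorder_cases) auto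
    then have "S ! i = S ! i'" using assms i by (auto dest: inj_onD)
    then show "i = i'" using less[of i i'] less[of i' i] i
      by (cases i i' rule: linorder_cases) auto
  qed
qed

lemma sorted_at_sort_pos:
  "inj_on code (set S) \<Longrightarrow> i < length S \<Longrightarrow> sorted_at code S (sort_pos code S i) = i"
  unfolding sorted_at_def by (intro inv_into_f_f inj_on_sort_pos) auto

text \<open>Equal characters are contiguous in the sorted order and keep their text order, so only
  the occurrences in between separate the two ranks.\<close>

lemma sort_pos_same:
  assumes "S ! i' = S ! i" "i \<le> i'" "i' < length S"
  shows "sort_pos code S i' = sort_pos code S i + occ S i i' (S ! i)"
  unfolding sort_pos_def occ_def using assms
  by (subst card_Un_disjoint[symmetric]) (auto intro!: arg_cong[where f = card])

text \<open>Position \<open>i\<close> is itself the first occurrence, hence \<open>k - 1\<close>.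
  The value \<open>length S\<close> acts as infinity, and it also pads the positions past the end,
  so that the last block can be treated as full.\<close>

definition kth_occ :: "('a \<Rightarrow> nat) \<Rightarrow> 'a list \<Rightarrow> nat \<Rightarrow> nat \<Rightarrow> nat" where
  "kth_occ code S k i =
     (if i < length S \<and> k \<le> occ S i (length S) (S ! i)
      then sorted_at code S (sort_pos code S i + (k - 1)) else length S)"

lemma kth_occ_index:
  assumes "inj_on code (set S)" "i < length S" "0 < k" "k \<le> occ S i (length S) (S ! i)"
  shows "sort_pos code S i + (k - 1) < length S"
    and "kth_occ code S k i < length S"
    and "i < b \<Longrightarrow> b \<le> length S \<Longrightarrow> kth_occ code S k i < b \<longleftrightarrow> k \<le> occ S i b (S ! i)"
proof -
  have "k - 1 < occ S i (length S) (S ! i)" using assms(3,4) by simp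
  from nth_occurrence_exists[OF this] obtain i' where i': "i \<le> i'" "i' < length S" "S ! i' = S ! i"
    "occ S i i' (S ! i) = k - 1"
    by blast
  have eq: "sort_pos code S i + (k - 1) = sort_pos code S i'"
    using sort_pos_same[OF i'(3,1,2), of code] i'(4) by simp
  then show "sort_pos code S i + (k - 1) < length S" using sort_pos_less[OF i'(2)] by simp
  have kth: "kth_occ code S k i = i'"
    using assms(2,4) eq sorted_at_sort_pos[OF assms(1) i'(2)] by (simp add: kth_occ_def)
  then show "kth_occ code S k i < length S" using i'(2) by simp
  assume b: "i < b" "b \<le> length S"
  show "kth_occ code S k i < b \<longleftrightarrow> k \<le> occ S i b (S ! i)"
  proof
    assume "kth_occ code S k i < b"
    then have "occ S i (Suc i') (S ! i) \<le> occ S i b (S ! i)" using kth by (intro occ_mono) auto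
    then show "k \<le> occ S i b (S ! i)" using i' assms(3) by (simp add: occ_Suc)
  next
    assume k: "k \<le> occ S i b (S ! i)"
    show "kth_occ code S k i < b"
    proof (rule ccontr)
      assume "\<not> ?thesis"
      then have "occ S i b (S ! i) \<le> occ S i i' (S ! i)" using kth by (intro occ_mono) auto
      then show False using i' assms(3) k by simp
    qed
  qed
qed

text \<open>Turns counting into a comparison with an exclusive right end. The default value
  \<open>length S\<close> is never below \<open>b\<close>, in agreement with a count that is too
  small.\<close>

lemma kth_occ_less_iff:
  assumes "inj_on code (set S)" "0 < k" "i < b" "b \<le> length S"
  shows "kth_occ code S k i < b \<longleftrightarrow> k \<le> occ S i b (S ! i)"
proof (cases "k \<le> occ S i (length S) (S ! i)")
  case True
  then show ?thesis using kth_occ_index(3)[OF assms(1) _ assms(2) True assms(3,4)] assms(3,4) by simp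
next
  case False
  moreover have "occ S i b (S ! i) \<le> occ S i (length S) (S ! i)"
    using assms(4) by (intro occ_mono) auto
  ultimately show ?thesis using assms(4) by (simp add: kth_occ_def)
qed

lemma count_range_mset: "count (range_mset S l r) c = occ S l (Suc r) c"
proof -
  have "count (range_mset S l r) c = card {i \<in> {l..r}. S ! i = c}"
  proof -
    have "count (range_mset S l r) c = (\<Sum>i | i \<in> {l..r} \<and> c = S ! i. count (mset_set {l..r}) i)"
      by (simp add: range_mset_def count_image_mset')
    also have "\<dots> = (\<Sum>i | i \<in> {l..r} \<and> c = S ! i. 1)"
      by (intro sum.cong) auto
    also have "\<dots> = card {i \<in> {l..r}. S ! i = c}"
      unfolding card_eq_sum by (intro sum.cong) auto
    finally show ?thesis .
  qed
  then show ?thesis by (simp add: occ_def atLeastLessThanSuc_atLeastAtMost)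
qed

text \<open>\<open>H\<close> keeps just the first occurrence of each mode: if an equal character
  preceded a member of \<open>H\<close> within the range, that earlier position would see
  \<open>k + 1\<close> occurrences.\<close>

lemma range_modes_eq:
  fixes k l r :: nat and S :: "'a list"
  defines "H \<equiv> {i \<in> {l..<Suc r}. k \<le> occ S i (Suc r) (S ! i)}"
  assumes k: "0 < k" and ex: "H \<noteq> {}"
    and max: "\<And>i. l \<le> i \<Longrightarrow> i \<le> r \<Longrightarrow> \<not> k + 1 \<le> occ S i (Suc r) (S ! i)"
  shows "inj_on ((!) S) H" and "(!) S ` H = range_modes S l r"
proof -
  have first: "\<exists>i. l \<le> i \<and> i \<le> r \<and> S ! i = c \<and> occ S i (Suc r) c = occ S l (Suc r) c"
    if c: "0 < occ S l (Suc r) c" for c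
  proof -
    obtain i where i: "l \<le> i" "i < Suc r" "S ! i = c" "occ S l i c = 0"
      using nth_occurrence_exists[OF c] by blast
    then have "occ S i (Suc r) c = occ S l (Suc r) c"
      using occ_add[of l i "Suc r" S c] by simp
    then show ?thesis using i by (intro exI[of _ i]) auto
  qed
  have le: "occ S l (Suc r) c \<le> k" for c
  proof (cases "0 < occ S l (Suc r) c")
    case True
    then obtain i where "l \<le> i" "i \<le> r" "S ! i = c" "occ S i (Suc r) c = occ S l (Suc r) c"
      using first by blast
    then show ?thesis using max[of i] by auto
  qed simp
  have H: "occ S l (Suc r) (S ! i) = k" if "i \<in> H" for i
    using that le[of "S ! i"] occ_mono[of l i "Suc r" "Suc r" S "S ! i"] by (auto simp: H_def)
  show "inj_on ((!) S) H"
  proof (rule linorder_inj_onI)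
    fix i i' assume i: "i < i'" "i \<in> H" "i' \<in> H"
    have "occ S i (Suc r) (S ! i) = occ S i i' (S ! i) + occ S i' (Suc r) (S ! i)"
      using i by (intro occ_add) (auto simp: H_def)
    moreover have "0 < occ S i i' (S ! i)" using i(1) by (intro occ_first) auto
    moreover have "occ S i (Suc r) (S ! i) \<le> k"
      using max[of i] i(2) by (auto simp: H_def)
    moreover have "k \<le> occ S i' (Suc r) (S ! i')" using i(3) by (simp add: H_def)
    ultimately show "S ! i \<noteq> S ! i'" by auto
  qed auto
  have mode: "c \<in> range_modes S l r \<longleftrightarrow> occ S l (Suc r) c = k" for c
  proof -
    obtain i where "i \<in> H" using ex by blast
    then have top: "occ S l (Suc r) (S ! i) = k" by (rule H)
    have "c \<in> range_modes S l r \<longleftrightarrow> 0 < occ S l (Suc r) c \<and>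
        (\<forall>d. 0 < occ S l (Suc r) d \<longrightarrow> occ S l (Suc r) d \<le> occ S l (Suc r) c)"
      unfolding range_modes_def is_mode_def mem_Collect_eq count_greater_zero_iff[symmetric]
        count_range_mset ..
    also have "\<dots> \<longleftrightarrow> occ S l (Suc r) c = k"
    proof
      assume "0 < occ S l (Suc r) c \<and>
        (\<forall>d. 0 < occ S l (Suc r) d \<longrightarrow> occ S l (Suc r) d \<le> occ S l (Suc r) c)"
      then have "k \<le> occ S l (Suc r) c" using top k by fastforce
      then show "occ S l (Suc r) c = k" using le[of c] by simp
    qed (use k le in simp)
    finally show ?thesis .
  qed
  show "(!) S ` H = range_modes S l r"
  proof
    show "(!) S ` H \<subseteq> range_modes S l r" using H mode by blast
    show "range_modes S l r \<subseteq> (!) S ` H"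
    proof
      fix c assume "c \<in> range_modes S l r"
      then have c: "occ S l (Suc r) c = k" using mode by simp
      then obtain i where "l \<le> i" "i \<le> r" "S ! i = c" "occ S i (Suc r) c = k"
        using first[of c] k by auto
      then show "c \<in> (!) S ` H" by (auto simp: H_def)
    qed
  qed
qed

section \<open>The data structure\<close>

declare eval.simps [simp del] apply_binop.simps [simp del]

text \<open>The index of the tree table gives two quarters of \<open>b\<close> to the code and one
  quarter to each bound; the subtracted 1 pays for the odd bit of the code length 2 s + 1.\<close>

definition block_expr :: expr where
  "block_expr = Bin DIV (Bin SUB width_expr (Const 1)) (Const 4)"

definition shared_expr :: "nat \<Rightarrow> expr \<Rightarrow> expr" where
  "shared_expr t i = field_expr (Bin ADD (Bin MUL (Const t) (Bin SHL (Const 1) width_expr)) i)"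

definition blocks_expr :: expr where
  "blocks_expr = Bin ADD (Bin DIV TextLen block_expr) (Const 1)"

definition superblocks_expr :: expr where
  "superblocks_expr = Bin ADD (Bin DIV blocks_expr block_expr) (Const 1)"

definition level_size_expr :: expr where
  "level_size_expr =
     Bin ADD (Bin ADD blocks_expr superblocks_expr) (Bin MUL width_expr superblocks_expr)"

definition level_expr :: "expr \<Rightarrow> expr \<Rightarrow> expr" where
  "level_expr k g = field_expr
     (Bin ADD (Bin ADD (Bin MUL (Const 5) (Bin SHL (Const 1) width_expr)) (Bin MUL k level_size_expr)) g)"

definition kth_expr :: "expr \<Rightarrow> expr \<Rightarrow> expr" where
  "kth_expr k i = if_expr (Bin LT (shared_expr 2 i) k) TextLen
     (shared_expr 0 (Bin ADD (shared_expr 1 i) (Bin SUB k (Const 1))))"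

definition better_expr :: "expr \<Rightarrow> expr \<Rightarrow> expr \<Rightarrow> expr" where
  "better_expr k p q = if_expr (Bin LT (kth_expr k q) (kth_expr k p)) q p"

text \<open>A mixed-radix index with radix s + 1, because exclusive right bounds reach s.\<close>

definition pick_expr :: "expr \<Rightarrow> expr \<Rightarrow> expr \<Rightarrow> expr" where
  "pick_expr c a b = (let s = Bin ADD block_expr (Const 1) in
     shared_expr 4 (Bin ADD (Bin MUL (Bin ADD (Bin MUL c s) a) s) b))"

definition in_block_expr :: "expr \<Rightarrow> expr \<Rightarrow> expr \<Rightarrow> expr \<Rightarrow> expr" where
  "in_block_expr k x a b =
     Bin ADD (Bin MUL x block_expr) (pick_expr (level_expr k x) a b)"

text \<open>A superblock is a block whose elements are blocks: its tree selects the block with the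
  least minimum, and the tree of that block yields the position.\<close>

definition in_superblock_expr :: "expr \<Rightarrow> expr \<Rightarrow> expr \<Rightarrow> expr \<Rightarrow> expr" where
  "in_superblock_expr k x a b =
     in_block_expr k
       (Bin ADD (Bin MUL x block_expr) (pick_expr (level_expr k (Bin ADD blocks_expr x)) a b))
       (Const 0) block_expr"

text \<open>The sparse-table query: two possibly overlapping runs of 2 ^ j superblocks, one from
  each end, where j is the logarithm of the length.\<close>

definition superblock_range_expr :: "expr \<Rightarrow> expr \<Rightarrow> expr \<Rightarrow> expr" where
  "superblock_range_expr k x y =
     (let j = shared_expr 3 (Bin SUB y x);
          g = Bin ADD (Bin ADD blocks_expr superblocks_expr) (Bin MUL j superblocks_expr) in
      better_expr k (level_expr k (Bin ADD g x))
        (level_expr k (Bin ADD g (Bin SUB y (Bin SHL (Const 1) j)))))"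

text \<open>Combines the tail of the first block, the whole blocks in between and the head of the
  last block. It is generic because \<open>mid\<close> for blocks of positions is again such a
  split, with blocks grouped into superblocks.\<close>

definition split_expr ::
  "expr \<Rightarrow> (expr \<Rightarrow> expr \<Rightarrow> expr \<Rightarrow> expr) \<Rightarrow> (expr \<Rightarrow> expr \<Rightarrow> expr) \<Rightarrow> expr \<Rightarrow> expr \<Rightarrow> expr" where
  "split_expr k inn mid a b =
     (let x = Bin DIV a block_expr; y = Bin DIV b block_expr; x1 = Bin ADD x (Const 1);
          ra = mod_expr a block_expr; rb = mod_expr b block_expr;
          p = inn x ra block_expr;
          q = if_expr (Bin LT x1 y) (better_expr k p (mid x1 y)) p in
      if_expr (Bin EQ x y) (inn x ra rb)
        (if_expr (Bin LT (Const 0) rb) (better_expr k q (inn y (Const 0) rb)) q))"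

definition rmq_expr :: "expr \<Rightarrow> expr \<Rightarrow> expr \<Rightarrow> expr" where
  "rmq_expr k = split_expr k (in_block_expr k)
     (split_expr k (in_superblock_expr k) (superblock_range_expr k))"

text \<open>
  Blocks of \<open>s = \<Theta>(log n)\<close> positions and superblocks of \<open>s\<close> blocks are represented by tree codes,
  and ranges of \<open>2 ^ j\<close> superblocks by the position of their minimum (\<open>sparse\<close>). All numbers have
  \<open>b\<close> bits; since \<open>b = \<Theta>(s)\<close>, these are \<open>O(n)\<close> bits for each \<open>k\<close>. The values of \<open>pos k\<close> are
  computed from the positions sorted by character, which are shared by all \<open>k\<close>. The entry \<open>n\<close> of
  table 2 has no other use and stores \<open>m\<close>.
\<close>

locale mode_data =
  fixes S :: "'a list" and code :: "'a \<Rightarrow> nat" and w :: nat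
  assumes code_inj: "inj_on code (set S)"
    and S_nonempty: "S \<noteq> []"
    and w_ge: "10 * (floor_log (length S) + 6) \<le> w"
begin

abbreviation n :: nat where "n \<equiv> length S"

abbreviation m :: nat where "m \<equiv> max_freq S"

text \<open>The offset 6 keeps \<open>s\<close> positive and \<open>n + 6\<close> below
  \<open>2 ^ b\<close> for every nonempty string.\<close>

definition b :: nat where "b = floor_log n + 6"

definition s :: nat where "s = (b - 1) div 4"

definition N1 :: nat where "N1 = n div s + 1"

definition N2 :: nat where "N2 = N1 div s + 1"

definition G :: nat where "G = N1 + N2 + b * N2"

definition M :: nat where "M = 5 * 2 ^ b + (m + 1) * G"

abbreviation pos :: "nat \<Rightarrow> nat \<Rightarrow> nat" where "pos \<equiv> kth_occ code S"

definition block_code :: "nat \<Rightarrow> nat \<Rightarrow> nat" where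
  "block_code k x = (SOME c. c < 2 ^ (2 * s + 1) \<and> (\<forall>a b. a < b \<and> b \<le> s \<longrightarrow>
     range_argmin (pos k) (x * s + a) (x * s + b) (x * s + block_pick s c a b)))"

definition block_min :: "nat \<Rightarrow> nat \<Rightarrow> nat" where
  "block_min k x = x * s + block_pick s (block_code k x) 0 s"

definition superblock_code :: "nat \<Rightarrow> nat \<Rightarrow> nat" where
  "superblock_code k x = (SOME c. c < 2 ^ (2 * s + 1) \<and> (\<forall>a b. a < b \<and> b \<le> s \<longrightarrow>
     range_argmin (\<lambda>y. pos k (block_min k y)) (x * s + a) (x * s + b) (x * s + block_pick s c a b)))"

definition sparse :: "nat \<Rightarrow> nat \<Rightarrow> nat \<Rightarrow> nat" where
  "sparse k j x = (SOME p. range_argmin (pos k) (x * (s * s)) ((x + 2 ^ j) * (s * s)) p)"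

definition shared :: "nat \<Rightarrow> nat \<Rightarrow> nat" where
  "shared t i =
     (if t = 0 then sorted_at code S i
      else if t = 1 then sort_pos code S i
      else if t = 2 then if i < n then occ S i n (S ! i) else m
      else if t = 3 then floor_log i
      else block_pick s (i div (s + 1) div (s + 1)) (i div (s + 1) mod (s + 1)) (i mod (s + 1)))"

definition level :: "nat \<Rightarrow> nat \<Rightarrow> nat" where
  "level k g =
     (if g < N1 then block_code k g
      else if g < N1 + N2 then superblock_code k (g - N1)
      else sparse k ((g - (N1 + N2)) div N2) ((g - (N1 + N2)) mod N2))"

text \<open>The reduction makes every field fit, since \<open>sparse\<close> entries for ranges that
  leave the string may be too large. Entries for ranges inside the string are positions below
  \<open>n\<close> and stay intact.\<close>

definition F :: "nat \<Rightarrow> nat" where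
  "F f = (if f < 5 * 2 ^ b then shared (f div 2 ^ b) (f mod 2 ^ b)
     else level ((f - 5 * 2 ^ b) div G) ((f - 5 * 2 ^ b) mod G)) mod 2 ^ b"

definition D :: "bool list" where "D = pack (n + 6) b M F"

section \<open>Size bounds that exclude overflow\<close>

lemma n_pos: "0 < n"
  using S_nonempty by simp

lemma n_b: "32 * n < 2 ^ b"
  using floor_log_exp2_gt[of n] by (simp add: b_def power_add)

lemma n6_b: "n + 6 < 2 ^ b"
  using n_b n_pos by linarith

lemma b_ge: "6 \<le> b"
  by (simp add: b_def)

lemma s_pos: "0 < s"
  using b_ge by (simp add: s_def)

lemma s_le: "4 * s + 1 \<le> b"
  using b_ge by (simp add: s_def)

lemma N1_le: "N1 \<le> n + 1"
  by (simp add: N1_def)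

lemma N2_le: "N2 \<le> n + 2"
  using N1_le div_le_dividend[of N1 s] unfolding N2_def by linarith

lemma G_le: "G \<le> 3 * 2 ^ (2 * b)"
proof -
  have "b * N2 \<le> 2 ^ b * 2 ^ b"
    using less_exp[of b] N2_le n6_b by (intro mult_le_mono) auto
  then have "b * N2 \<le> 2 ^ (2 * b)" by (simp add: mult_2 power_add)
  moreover have "(2::nat) ^ b \<le> 2 ^ (2 * b)" by (intro power_increasing) auto
  ultimately show ?thesis using N1_le N2_le n6_b unfolding G_def by linarith
qed

lemma mG_le: "(m + 1) * G \<le> 3 * 2 ^ (3 * b)"
proof -
  have "(m + 1) * G \<le> 2 ^ b * (3 * 2 ^ (2 * b))"
    using max_freq_le_length[of S] n6_b by (intro mult_le_mono G_le) auto
  also have "\<dots> = 3 * 2 ^ (3 * b)" by (simp flip: power_add)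
  finally show ?thesis .
qed

lemma M_less_pow: "M < 2 ^ (5 * b)"
proof -
  have "(2::nat) ^ b \<le> 2 ^ (3 * b)" by (intro power_increasing) auto
  then have "M \<le> 8 * 2 ^ (3 * b)" using mG_le unfolding M_def by linarith
  also have "\<dots> < 2 ^ 4 * 2 ^ (3 * b)" by simp
  also have "\<dots> = 2 ^ (4 + 3 * b)" by (simp add: power_add)
  also have "\<dots> \<le> 2 ^ (5 * b)" using b_ge by (intro power_increasing) auto
  finally show ?thesis .
qed

sublocale packed w "map code S" D n b M F
proof
  show "0 < w" "10 * b \<le> w" using w_ge by (simp_all add: b_def)
  show "b < 2 ^ (n + 6)"
  proof -
    have "2 ^ floor_log n \<le> n" using n_pos by (rule floor_log_exp2_le)
    then have "b < n + 6" using less_exp[of "floor_log n"] unfolding b_def by linarith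
    then show ?thesis using less_exp[of "n + 6"] by linarith
  qed
qed (use n6_b M_less_pow b_ge in \<open>auto simp: D_def F_def\<close>)

lemma block_code:
  "block_code k x < 2 ^ (2 * s + 1)"
  "a < c \<Longrightarrow> c \<le> s \<Longrightarrow>
    range_argmin (pos k) (x * s + a) (x * s + c) (x * s + block_pick s (block_code k x) a c)"
proof -
  have "block_code k x < 2 ^ (2 * s + 1) \<and> (\<forall>a c. a < c \<and> c \<le> s \<longrightarrow>
      range_argmin (pos k) (x * s + a) (x * s + c) (x * s + block_pick s (block_code k x) a c))"
    unfolding block_code_def by (rule someI_ex) (rule block_code_exists)
  then show "block_code k x < 2 ^ (2 * s + 1)" "a < c \<Longrightarrow> c \<le> s \<Longrightarrow>
      range_argmin (pos k) (x * s + a) (x * s + c) (x * s + block_pick s (block_code k x) a c)"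
    by simp_all
qed

lemma superblock_code:
  "superblock_code k x < 2 ^ (2 * s + 1)"
  "a < c \<Longrightarrow> c \<le> s \<Longrightarrow> range_argmin (\<lambda>y. pos k (block_min k y)) (x * s + a) (x * s + c)
     (x * s + block_pick s (superblock_code k x) a c)"
proof -
  have "superblock_code k x < 2 ^ (2 * s + 1) \<and> (\<forall>a c. a < c \<and> c \<le> s \<longrightarrow>
      range_argmin (\<lambda>y. pos k (block_min k y)) (x * s + a) (x * s + c)
        (x * s + block_pick s (superblock_code k x) a c))"
    unfolding superblock_code_def by (rule someI_ex) (rule block_code_exists)
  then show "superblock_code k x < 2 ^ (2 * s + 1)" "a < c \<Longrightarrow> c \<le> s \<Longrightarrow>
      range_argmin (\<lambda>y. pos k (block_min k y)) (x * s + a) (x * s + c)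
        (x * s + block_pick s (superblock_code k x) a c)"
    by simp_all
qed

lemma sparse: "range_argmin (pos k) (x * (s * s)) ((x + 2 ^ j) * (s * s)) (sparse k j x)"
  unfolding sparse_def by (rule someI_ex, rule range_argmin_exists) (use s_pos in simp)

lemma block_min: "range_argmin (pos k) (x * s) ((x + 1) * s) (block_min k x)"
  using block_code(2)[of 0 s k x] s_pos unfolding block_min_def by (simp add: algebra_simps)

section \<open>Correctness of the compiled expressions\<close>

lemma small_less_w: "x \<le> n + 5 \<Longrightarrow> x < 2 ^ w"
  using n6_b by (intro less_w) linarith

lemma ev_block: "ev st block_expr = s"
proof -
  have "b < 2 ^ w" by (intro less_w) simp
  then have "ev st (Bin SUB width_expr (Const 1)) = b - 1"
    using b_ge one_less by (intro ev_SUB ev_width ev_Const) linarith+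
  moreover have "b - 1 < 2 ^ w" using \<open>b < 2 ^ w\<close> by linarith
  moreover have "ev st (Const 4) = 4" using small_less_w[of 4] by (intro ev_Const) simp
  ultimately show ?thesis unfolding block_expr_def s_def by (intro ev_DIV)
qed

lemma ev_blocks: "ev st blocks_expr = N1"
proof -
  have "ev st (Bin DIV TextLen block_expr) = n div s"
    by (intro ev_DIV ev_n ev_block small_less_w) simp
  then show ?thesis unfolding blocks_expr_def N1_def
    using div_le_dividend[of n s] by (intro ev_ADD ev_Const small_less_w) linarith+
qed

lemma ev_superblocks: "ev st superblocks_expr = N2"
proof -
  have "ev st (Bin DIV blocks_expr block_expr) = N1 div s"
    using N1_le by (intro ev_DIV ev_blocks ev_block small_less_w) simp
  then show ?thesis unfolding superblocks_expr_def N2_def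
    using div_le_dividend[of N1 s] N1_le by (intro ev_ADD ev_Const small_less_w) linarith+
qed

lemma less_pow3_w: "x \<le> 10 * 2 ^ (3 * b) \<Longrightarrow> x < 2 ^ w" for x :: nat
proof -
  assume "x \<le> 10 * 2 ^ (3 * b)"
  also have "\<dots> < 2 ^ 4 * 2 ^ (3 * b)" by simp
  also have "\<dots> = 2 ^ (4 + 3 * b)" by (simp add: power_add)
  also have "\<dots> \<le> 2 ^ w" using b_ge by (intro pow_w) auto
  finally show ?thesis .
qed

lemma pow_le_pow3: "(2::nat) ^ b \<le> 2 ^ (3 * b)" "(2::nat) ^ (2 * b) \<le> 2 ^ (3 * b)"
  by (auto intro: power_increasing)

lemma ev_level_size: "ev st level_size_expr = G"
proof -
  have "G < 2 ^ w" using G_le pow_le_pow3 by (intro less_pow3_w) linarith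
  then show ?thesis
    unfolding level_size_expr_def G_def
    by (intro ev_ADD ev_MUL ev_blocks ev_superblocks ev_width) auto
qed

lemma ev_pow_b: "ev st (Bin SHL (Const 1) width_expr) = 2 ^ b"
  using b_le b_pos by (intro ev_SHL_1 ev_width) simp

lemma ev_shared:
  assumes "ev st e = i" "i < 2 ^ b" "t < 5" "shared t i < 2 ^ b"
  shows "ev st (shared_expr t e) = shared t i"
proof -
  have "t * 2 ^ b \<le> 4 * 2 ^ b" using assms(3) by (intro mult_le_mono1) simp
  then have f: "t * 2 ^ b + i < 5 * 2 ^ b" using assms(2) by linarith
  moreover have "5 * 2 ^ b \<le> 10 * (2::nat) ^ (3 * b)" using pow_le_pow3 by linarith
  ultimately have "t * 2 ^ b + i < 2 ^ w" by (intro less_pow3_w) linarith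
  moreover have "t < 2 ^ w" using assms(3) n6_b by (intro less_w) linarith
  ultimately have "ev st (shared_expr t e) = F (t * 2 ^ b + i)"
    unfolding shared_expr_def using assms(1) f
    by (intro ev_field_expr ev_ADD ev_MUL ev_Const ev_pow_b) (auto simp: M_def)
  also have "\<dots> = shared t i mod 2 ^ b" unfolding F_def using f assms(2) by simp
  finally show ?thesis using assms(4) by simp
qed

lemma ev_level:
  assumes "ev st ek = k" "k \<le> m" "ev st e = g" "g < G" "level k g < 2 ^ b"
  shows "ev st (level_expr ek e) = level k g"
proof -
  have "k * G + g < (k + 1) * G" using assms(4) by simp
  also have "\<dots> \<le> (m + 1) * G" using assms(2) by (intro mult_le_mono1) simp
  finally have kG: "k * G + g < (m + 1) * G" .
  then have "5 * 2 ^ b + k * G + g < M" by (simp add: M_def)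
  moreover have "M < 2 ^ w" using mG_le pow_le_pow3 unfolding M_def by (intro less_pow3_w) linarith
  moreover have "5 < (2::nat) ^ w" using n6_b by (intro less_w) linarith
  ultimately have "ev st (level_expr ek e) = F (5 * 2 ^ b + k * G + g)"
    unfolding level_expr_def using assms(1,3)
    by (intro ev_field_expr ev_ADD ev_MUL ev_Const ev_pow_b ev_level_size) auto
  also have "\<dots> = level k g mod 2 ^ b" unfolding F_def using assms(4) by simp
  finally show ?thesis using assms(5) by simp
qed

text \<open>With too few remaining occurrences the lookup in table 0 is meaningless and
  \<open>if_expr\<close> discards it; otherwise \<open>kth_occ_index\<close> keeps the index and the
  result in range.\<close>

lemma ev_kth:
  assumes "wf_state w st" "ev st ek = k" "0 < k" "k \<le> m" "ev st e = i" "i < n"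
  shows "ev st (kth_expr ek e) = pos k i"
proof -
  have small: "x \<le> n \<Longrightarrow> x < 2 ^ b" for x using n6_b by linarith
  have "occ S i n (S ! i) \<le> n"
    using occ_le_max_freq[of i S n i] max_freq_le_length[of S] assms(6) by linarith
  then have rem: "ev st (shared_expr 2 e) = occ S i n (S ! i)"
    using ev_shared[OF assms(5), of 2] assms(6) small by (simp add: shared_def)
  have c: "ev st (Bin LT (shared_expr 2 e) ek) = of_bool (occ S i n (S ! i) < k)"
    unfolding ev_LT rem assms(2) ..
  show ?thesis
  proof (cases "occ S i n (S ! i) < k")
    case True
    then show ?thesis unfolding kth_expr_def ev_if_expr[OF assms(1) c] ev_n by (simp add: kth_occ_def)
  next
    case False
    then have k: "k \<le> occ S i n (S ! i)" by simp
    define q where "q = sort_pos code S i + (k - 1)"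
    have q: "q < n" "sorted_at code S q < n"
      using kth_occ_index(1,2)[OF code_inj assms(6,3) k] assms(6) k
      by (simp_all add: kth_occ_def q_def)
    have "ev st (shared_expr 1 e) = sort_pos code S i"
      using ev_shared[OF assms(5), of 1] assms(6) small[of i] small[of "sort_pos code S i"]
        sort_pos_less[OF assms(6), of code] by (simp add: shared_def)
    moreover have "ev st (Bin SUB ek (Const 1)) = k - 1"
      using assms(2,3) one_less eval_less[OF assms(1), of "map code S" D ek]
      by (intro ev_SUB ev_Const) auto
    ultimately have "ev st (Bin ADD (shared_expr 1 e) (Bin SUB ek (Const 1))) = q"
      unfolding q_def using small[of q] q(1) by (intro ev_ADD less_w) (auto simp: q_def)
    then have "ev st (shared_expr 0 (Bin ADD (shared_expr 1 e) (Bin SUB ek (Const 1)))) = sorted_at code S q"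
      using ev_shared[of st _ q 0] small q by (simp add: shared_def)
    then show ?thesis unfolding kth_expr_def ev_if_expr[OF assms(1) c]
      using False assms(6) by (simp add: kth_occ_def q_def)
  qed
qed

lemma ev_better:
  assumes "wf_state w st" "ev st ek = k" "0 < k" "k \<le> m"
    and "range_argmin (pos k) a a' (ev st p)" "range_argmin (pos k) c c' (ev st q)"
    and "a \<le> c" "c \<le> a'" "a' \<le> c'" "c' \<le> n"
  shows "range_argmin (pos k) a c' (ev st (better_expr ek p q))"
proof -
  have "ev st p < n" "ev st q < n" using assms(5-) by (auto simp: range_argmin_def)
  then have "ev st (kth_expr ek p) = pos k (ev st p)" "ev st (kth_expr ek q) = pos k (ev st q)"
    using ev_kth[OF assms(1-4)] by auto
  then have "ev st (Bin LT (kth_expr ek q) (kth_expr ek p)) = of_bool (pos k (ev st q) < pos k (ev st p))"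
    unfolding ev_LT by simp
  then have "ev st (better_expr ek p q) = (if pos k (ev st q) < pos k (ev st p) then ev st q else ev st p)"
    unfolding better_expr_def by (rule ev_if_expr[OF assms(1)])
  then show ?thesis using range_argmin_union[OF assms(5-9)] by simp
qed

lemma ev_pick:
  assumes "ev st ec = c" "c < 2 ^ (2 * s + 1)" "ev st ea = i" "i \<le> s" "ev st eb = j" "j \<le> s"
    and "block_pick s c i j < 2 ^ b"
  shows "ev st (pick_expr ec ea eb) = block_pick s c i j"
proof -
  define u where "u = s + 1"
  have ij: "i < u" "j < u" using assms by (simp_all add: u_def)
  \<comment> \<open>Each of the two radices costs at most \<open>s\<close> bits beside the
    \<open>2 * s + 1\<close> bits of the code, and \<open>4 * s + 1 \<le> b\<close>.\<close>
  have "u \<le> 2 ^ s" unfolding u_def using less_exp[of s] by linarith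
  then have "2 ^ (2 * s + 1) * u * u \<le> 2 ^ (2 * s + 1) * 2 ^ s * 2 ^ s"
    by (intro mult_le_mono order_refl)
  also have "\<dots> = 2 ^ (2 * s + 1 + s + s)" by (simp only: power_add)
  also have "2 * s + 1 + s + s = 4 * s + 1" by simp
  also have "2 ^ (4 * s + 1) \<le> (2::nat) ^ b" using s_le by (intro power_increasing) auto
  finally have le: "2 ^ (2 * s + 1) * u * u \<le> 2 ^ b" .
  have "c * u + i < (c + 1) * u" unfolding add_mult_distrib using ij by linarith
  also have "\<dots> \<le> 2 ^ (2 * s + 1) * u" using assms(2) by (intro mult_le_mono1) simp
  finally have "c * u + i + 1 \<le> 2 ^ (2 * s + 1) * u" by simp
  then have "(c * u + i + 1) * u \<le> 2 ^ (2 * s + 1) * u * u" by (rule mult_le_mono1)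
  moreover have "(c * u + i) * u + j < (c * u + i + 1) * u"
    unfolding add_mult_distrib[of _ 1] using ij by linarith
  ultimately have idx: "(c * u + i) * u + j < 2 ^ b" using le by linarith
  have "z * 1 \<le> z * u" for z unfolding u_def by (intro mult_le_mono2) simp
  then have "c * u + i \<le> (c * u + i) * u + j" by (intro trans_le_add1) simp
  then have "c * u + i < 2 ^ b" using idx by (rule le_less_trans)
  then have idx': "(c * u + i) * u + j < 2 ^ w" "c * u + i < 2 ^ w"
    using idx by (auto intro: less_w)
  have "ev st (Bin ADD block_expr (Const 1)) = u"
    unfolding u_def using s_le less_exp[of b] less_w[of "s + 1"] one_less
    by (intro ev_ADD ev_block ev_Const) linarith+
  then have evi: "ev st (Bin ADD (Bin MUL (Bin ADD (Bin MUL ec (Bin ADD block_expr (Const 1))) ea)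
      (Bin ADD block_expr (Const 1))) eb) = (c * u + i) * u + j"
    using idx' by (intro ev_ADD ev_MUL assms(1,3,5)) simp_all
  have dm: "(x * u + r) div u = x" "(x * u + r) mod u = r" if "r < u" for x r
    using that by simp_all
  have sh: "shared 4 x = block_pick s (x div u div u) (x div u mod u) (x mod u)" for x
    unfolding u_def by (simp add: shared_def)
  have sh4: "shared 4 ((c * u + i) * u + j) = block_pick s c i j"
    unfolding sh dm[OF ij(2)] dm[OF ij(1)] ..
  show ?thesis
    unfolding pick_expr_def Let_def sh4[symmetric]
    by (rule ev_shared[OF evi idx]) (simp_all add: sh4 assms(7))
qed

lemma code_less_pow: "c < 2 ^ (2 * s + 1) \<Longrightarrow> c < 2 ^ b" for c :: nat
proof -
  assume "c < 2 ^ (2 * s + 1)"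
  also have "(2::nat) ^ (2 * s + 1) \<le> 2 ^ b" using s_le by (intro power_increasing) auto
  finally show ?thesis .
qed

lemma index_less:
  assumes "x * s + c \<le> y"
  shows "x < y div s + 1"
proof -
  have "x * s \<le> y" using assms by simp
  then show ?thesis using s_pos by (simp add: less_eq_div_iff_mult_less_eq less_Suc_eq_le)
qed

lemma ev_in_block:
  assumes "ev st ek = k" "k \<le> m" "ev st ex = x" "ev st ea = a" "ev st ec = c"
    and "a < c" "c \<le> s" "x * s + c \<le> n"
  shows "ev st (in_block_expr ek ex ea ec) = x * s + block_pick s (block_code k x) a c"
proof -
  have x: "x < N1" unfolding N1_def by (rule index_less) (rule assms(8))
  have "level k x = block_code k x" using x by (simp add: level_def)
  then have lev: "ev st (level_expr ek ex) = block_code k x"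
    using ev_level[OF assms(1-3)] x block_code(1)[of k x] code_less_pow by (simp add: G_def)
  have "x * s + block_pick s (block_code k x) a c < n"
    using block_code(2)[OF assms(6,7), of k x] assms(8) by (auto simp: range_argmin_def)
  then have small: "x * s + block_pick s (block_code k x) a c < 2 ^ b" using n6_b by linarith
  then have "ev st (pick_expr (level_expr ek ex) ea ec) = block_pick s (block_code k x) a c"
    using assms(6,7) by (intro ev_pick lev block_code(1) assms(4,5)) auto
  then show ?thesis unfolding in_block_expr_def
    using less_w[OF small] by (intro ev_ADD ev_MUL assms(3) ev_block) auto
qed

lemma ev_in_superblock:
  assumes "ev st ek = k" "k \<le> m" "ev st ex = x" "ev st ea = a" "ev st ec = c"
    and "a < c" "c \<le> s" "(x * s + c) * s \<le> n"
  shows "range_argmin (pos k) ((x * s + a) * s) ((x * s + c) * s) (ev st (in_superblock_expr ek ex ea ec))"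
proof -
  have xs: "x * s + c \<le> n div s" using assms(8) s_pos by (simp add: less_eq_div_iff_mult_less_eq)
  then have "x * s + c \<le> N1" by (simp add: N1_def)
  then have x: "x < N2" unfolding N2_def by (rule index_less)
  have "level k (N1 + x) = superblock_code k x" using x by (simp add: level_def)
  moreover have "ev st (Bin ADD blocks_expr ex) = N1 + x"
  proof (intro ev_ADD ev_blocks assms(3) less_pow3_w)
    show "N1 + x \<le> 10 * 2 ^ (3 * b)" using x N1_le N2_le n6_b pow_le_pow3 by linarith
  qed
  ultimately have lev: "ev st (level_expr ek (Bin ADD blocks_expr ex)) = superblock_code k x"
    using ev_level[OF assms(1,2)] x superblock_code(1)[of k x] code_less_pow by (simp add: G_def)
  define y where "y = x * s + block_pick s (superblock_code k x) a c"
  have y: "range_argmin (\<lambda>y. pos k (block_min k y)) (x * s + a) (x * s + c) y"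
    unfolding y_def by (rule superblock_code(2)[OF assms(6,7)])
  then have y_less: "y < x * s + c" by (simp add: range_argmin_def)
  then have small: "y < 2 ^ b" using xs div_le_dividend[of n s] n6_b by linarith
  then have "ev st (pick_expr (level_expr ek (Bin ADD blocks_expr ex)) ea ec) =
      block_pick s (superblock_code k x) a c"
    using assms(6,7) by (intro ev_pick lev superblock_code(1) assms(4,5)) (auto simp: y_def)
  then have evy: "ev st (Bin ADD (Bin MUL ex block_expr)
      (pick_expr (level_expr ek (Bin ADD blocks_expr ex)) ea ec)) = y"
    unfolding y_def using less_w[OF small]
    by (intro ev_ADD ev_MUL assms(3) ev_block) (auto simp: y_def)
  \<comment> \<open>The selected block lies entirely inside the string, as
    \<open>ev_in_block\<close> demands.\<close>
  have "y * s + s = (y + 1) * s" by simp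
  also have "\<dots> \<le> (x * s + c) * s" using y_less by (intro mult_le_mono1) simp
  finally have "y * s + s \<le> n" using assms(8) by linarith
  then have "ev st (in_superblock_expr ek ex ea ec) = block_min k y"
    unfolding in_superblock_expr_def block_min_def
    using s_pos one_less by (intro ev_in_block assms(1,2) evy ev_block ev_Const) auto
  then show ?thesis using range_argmin_blocks[OF block_min y] by simp
qed

lemma ev_sparse:
  assumes "ev st ek = k" "k \<le> m" "ev st ex = x" "ev st ej = j"
    and "(x + 2 ^ j) * (s * s) \<le> n"
  shows "ev st (level_expr ek (Bin ADD (Bin ADD (Bin ADD blocks_expr superblocks_expr)
    (Bin MUL ej superblocks_expr)) ex)) = sparse k j x"
proof -
  have xjn: "x + 2 ^ j \<le> n div s div s"
    using assms(5) s_pos by (simp add: less_eq_div_iff_mult_less_eq flip: div_mult2_eq)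
  also have "\<dots> \<le> N1 div s" by (intro div_le_mono) (simp add: N1_def)
  finally have xj: "x + 2 ^ j < N2" by (simp add: N2_def)
  then have x: "x < N2" by simp
  \<comment> \<open>Since \<open>2 ^ j\<close> superblocks fit into the string, \<open>j\<close> is
    at most \<open>floor_log n\<close>, and \<open>b\<close> rows of the sparse table
    suffice.\<close>
  have "2 ^ j < 2 * (2::nat) ^ floor_log n"
    using xjn div_le_dividend[of n s] div_le_dividend[of "n div s" s] floor_log_exp2_gt[of n]
    by linarith
  then have "(2::nat) ^ j < 2 ^ (floor_log n + 1)" by simp
  then have j: "j < b" unfolding b_def by (subst (asm) power_strict_increasing_iff) auto
  have "j * N2 + x < (j + 1) * N2" using x by simp
  also have "\<dots> \<le> b * N2" using j by (intro mult_le_mono1) simp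
  finally have g: "N1 + N2 + j * N2 + x < G" by (simp add: G_def)
  have "G < 2 ^ w" using G_le pow_le_pow3 by (intro less_pow3_w) linarith
  then have evg: "ev st (Bin ADD (Bin ADD (Bin ADD blocks_expr superblocks_expr)
      (Bin MUL ej superblocks_expr)) ex) = N1 + N2 + j * N2 + x"
    using g by (intro ev_ADD ev_MUL ev_blocks ev_superblocks assms(3,4)) auto
  have lev: "level k (N1 + N2 + j * N2 + x) = sparse k j x"
    using x by (simp add: level_def add.assoc)
  have "sparse k j x < n" using sparse[of k x j] assms(5) by (auto simp: range_argmin_def)
  then show ?thesis using ev_level[OF assms(1,2) evg g] lev n6_b by simp
qed

lemma ev_superblock_range:
  assumes wf: "wf_state w st" and k: "ev st ek = k" "0 < k" "k \<le> m"
    and xy: "ev st ex = x" "ev st ey = y" "x < y" "y * (s * s) \<le> n"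
  shows "range_argmin (pos k) (x * (s * s)) (y * (s * s)) (ev st (superblock_range_expr ek ex ey))"
proof -
  have "y * 1 \<le> y * (s * s)" using s_pos by (intro mult_le_mono2) (simp add: Suc_leI)
  then have y: "y \<le> n" using xy(4) by linarith
  define j where "j = floor_log (y - x)"
  have j: "2 ^ j \<le> y - x" "y - x < 2 * 2 ^ j"
    using floor_log_exp2_le[of "y - x"] floor_log_exp2_gt[of "y - x"] xy(3) by (simp_all add: j_def)
  have yw: "y < 2 ^ w" using y n6_b by (intro less_w) linarith
  have "ev st (Bin SUB ey ex) = y - x" using xy yw by (intro ev_SUB) auto
  moreover have jb: "j < 2 ^ b" using j(1) less_exp[of j] y n6_b by linarith
  ultimately have evj: "ev st (shared_expr 3 (Bin SUB ey ex)) = j"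
    using ev_shared[of st _ "y - x" 3] y n6_b by (simp add: shared_def j_def)
  have "(2::nat) ^ j < 2 ^ w" using j(1) yw by linarith
  then have "j < w" by (subst (asm) power_strict_increasing_iff) auto
  then have ev2j: "ev st (Bin SHL (Const 1) (shared_expr 3 (Bin SUB ey ex))) = 2 ^ j"
    by (intro ev_SHL_1 evj)
  have evy: "ev st (Bin SUB ey (Bin SHL (Const 1) (shared_expr 3 (Bin SUB ey ex)))) = y - 2 ^ j"
    using j(1) yw by (intro ev_SUB xy ev2j) auto
  have le: "z * (s * s) \<le> y * (s * s)" if "z \<le> y" for z using that by (rule mult_le_mono1)
  have "range_argmin (pos k) (x * (s * s)) ((x + 2 ^ j) * (s * s)) (sparse k j x)"
    "range_argmin (pos k) ((y - 2 ^ j) * (s * s)) (y * (s * s)) (sparse k j (y - 2 ^ j))"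
    using sparse[of k x j] sparse[of k "y - 2 ^ j" j] j(1) by simp_all
  moreover have "(x + 2 ^ j) * (s * s) \<le> n" "(y - 2 ^ j + 2 ^ j) * (s * s) \<le> n"
  proof -
    have "x + 2 ^ j \<le> y" "y - 2 ^ j + 2 ^ j \<le> y" using j(1) xy(3) by linarith+
    then show "(x + 2 ^ j) * (s * s) \<le> n" "(y - 2 ^ j + 2 ^ j) * (s * s) \<le> n"
      using le le_trans xy(4) by blast+
  qed
  ultimately show ?thesis
    unfolding superblock_range_expr_def Let_def
    using j xy(3) le[of "x + 2 ^ j"]
    by (intro ev_better[OF wf k, where a' = "(x + 2 ^ j) * (s * s)" and c = "(y - 2 ^ j) * (s * s)"])
      (simp_all only: ev_sparse[OF k(1,3) xy(1) evj] ev_sparse[OF k(1,3) evy evj] xy(4),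
        auto intro!: mult_le_mono1)
qed

text \<open>\<open>u\<close> is the length of one unit in positions: 1 if the units are positions,
  \<open>s\<close> if they are blocks. A last block with remainder 0 is skipped, because
  \<open>inn\<close> is specified for nonempty ranges only.\<close>

lemma ev_split:
  assumes wf: "wf_state w st" and k: "ev st ek = k" "0 < k" "k \<le> m"
    and inn: "\<And>ex ea ec x a c. \<lbrakk>ev st ex = x; ev st ea = a; ev st ec = c; a < c; c \<le> s; (x * s + c) * u \<le> n\<rbrakk> \<Longrightarrow>
      range_argmin (pos k) ((x * s + a) * u) ((x * s + c) * u) (ev st (inn ex ea ec))"
    and mid: "\<And>ex ey x y. \<lbrakk>ev st ex = x; ev st ey = y; x < y; y * (s * u) \<le> n\<rbrakk> \<Longrightarrow>
      range_argmin (pos k) (x * (s * u)) (y * (s * u)) (ev st (mid ex ey))"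
    and ac: "ev st ea = a" "ev st ec = c" "a < c" "c * u \<le> n" and u: "0 < u"
  shows "range_argmin (pos k) (a * u) (c * u) (ev st (split_expr ek inn mid ea ec))"
proof -
  have "c * 1 \<le> c * u" using u by (intro mult_le_mono2) simp
  then have c: "c \<le> n" using ac(4) by linarith
  have small: "z < 2 ^ w" if "z \<le> n + 1" for z using that n6_b by (intro less_w) linarith
  define x y where "x = a div s" and "y = c div s"
  define ra rc where "ra = a mod s" and "rc = c mod s"
  have a_eq: "a = x * s + ra" and c_eq: "c = y * s + rc" and r: "ra < s" "rc < s"
    using s_pos by (simp_all add: x_def y_def ra_def rc_def)
  have "x \<le> y" unfolding x_def y_def using ac(3) by (intro div_le_mono) simp
  have yn: "y \<le> n" unfolding y_def using c div_le_dividend[of c s] by linarith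
  have evx: "ev st (Bin DIV ea block_expr) = x" and evy: "ev st (Bin DIV ec block_expr) = y"
    unfolding x_def y_def using ac c by (auto intro!: ev_DIV ev_block small)
  have evra: "ev st (mod_expr ea block_expr) = ra" and evrc: "ev st (mod_expr ec block_expr) = rc"
    unfolding ra_def rc_def using ac c by (auto intro!: ev_mod_expr ev_block small)
  have evx1: "ev st (Bin ADD (Bin DIV ea block_expr) (Const 1)) = x + 1"
    using evx \<open>x \<le> y\<close> yn one_less by (intro ev_ADD ev_Const small) auto
  have ev0: "ev st (Const 0) = 0" by (intro ev_Const) simp
  have cond: "ev st (Bin EQ (Bin DIV ea block_expr) (Bin DIV ec block_expr)) = of_bool (x = y)"
    "ev st (Bin LT (Bin ADD (Bin DIV ea block_expr) (Const 1)) (Bin DIV ec block_expr)) = of_bool (x + 1 < y)"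
    "ev st (Bin LT (Const 0) (mod_expr ec block_expr)) = of_bool (0 < rc)"
    unfolding ev_EQ ev_LT evx evy evx1 evrc ev0 by simp_all
  have le: "z * u \<le> n" if "z \<le> c" for z using mult_le_mono1[OF that, of u] ac(4) by linarith
  show ?thesis
  proof (cases "x = y")
    case True
    then have "range_argmin (pos k) ((x * s + ra) * u) ((x * s + rc) * u)
        (ev st (inn (Bin DIV ea block_expr) (mod_expr ea block_expr) (mod_expr ec block_expr)))"
      using r ac(3,4) a_eq c_eq by (intro inn evx evra evrc) auto
    then show ?thesis
      unfolding split_expr_def Let_def ev_if_expr[OF wf cond(1)] using True a_eq c_eq by simp
  next
    case False
    then have xy: "x + 1 \<le> y" using \<open>x \<le> y\<close> by simp
    define p where "p = inn (Bin DIV ea block_expr) (mod_expr ea block_expr) block_expr"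
    define q where "q = if_expr (Bin LT (Bin ADD (Bin DIV ea block_expr) (Const 1)) (Bin DIV ec block_expr))
      (better_expr ek p (mid (Bin ADD (Bin DIV ea block_expr) (Const 1)) (Bin DIV ec block_expr))) p"
    have xs: "x * s + s \<le> y * s" using mult_le_mono1[OF xy, of s] by simp
    have "range_argmin (pos k) ((x * s + ra) * u) ((x * s + s) * u) (ev st p)"
      unfolding p_def using r xs c_eq by (intro inn evx evra ev_block le) auto
    then have p: "range_argmin (pos k) (a * u) ((x * s + s) * u) (ev st p)" using a_eq by simp
    have q: "range_argmin (pos k) (a * u) (y * s * u) (ev st q)"
    proof (cases "x + 1 < y")
      case True
      have "range_argmin (pos k) ((x + 1) * (s * u)) (y * (s * u))
          (ev st (mid (Bin ADD (Bin DIV ea block_expr) (Const 1)) (Bin DIV ec block_expr)))"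
        using True le[of "y * s"] c_eq by (intro mid evx1 evy) (auto simp: mult.assoc)
      then have mid': "range_argmin (pos k) ((x * s + s) * u) (y * s * u)
          (ev st (mid (Bin ADD (Bin DIV ea block_expr) (Const 1)) (Bin DIV ec block_expr)))"
        by (simp add: algebra_simps)
      have "a * u \<le> (x * s + s) * u" using a_eq r by (intro mult_le_mono1) simp
      moreover have "(x * s + s) * u \<le> y * s * u" using xs by (rule mult_le_mono1)
      moreover have "y * s * u \<le> n" using c_eq by (intro le) simp
      ultimately show ?thesis
        unfolding q_def ev_if_expr[OF wf cond(2)] using True ev_better[OF wf k p mid'] by simp
    next
      case False
      then have "x * s + s = y * s" using xy by (metis add.commute add_mult_distrib le_neq_implies_less mult_1)
      then show ?thesis unfolding q_def ev_if_expr[OF wf cond(2)] using False p by simp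
    qed
    have "range_argmin (pos k) (a * u) (c * u)
      (ev st (if_expr (Bin LT (Const 0) (mod_expr ec block_expr))
        (better_expr ek q (inn (Bin DIV ec block_expr) (Const 0) (mod_expr ec block_expr))) q))"
    proof (cases "0 < rc")
      case True
      have "range_argmin (pos k) ((y * s + 0) * u) ((y * s + rc) * u)
          (ev st (inn (Bin DIV ec block_expr) (Const 0) (mod_expr ec block_expr)))"
        using True r ac(4) c_eq by (intro inn evy ev0 evrc) auto
      then have inn': "range_argmin (pos k) (y * s * u) (c * u)
          (ev st (inn (Bin DIV ec block_expr) (Const 0) (mod_expr ec block_expr)))"
        using c_eq by simp
      have "a * u \<le> y * s * u" using a_eq r xs by (intro mult_le_mono1) simp
      moreover have "y * s * u \<le> c * u" using c_eq by (intro mult_le_mono1) simp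
      ultimately show ?thesis
        unfolding ev_if_expr[OF wf cond(3)] using True ev_better[OF wf k q inn'] ac(4) by simp
    next
      case False
      then have "c = y * s" using c_eq by simp
      then show ?thesis unfolding ev_if_expr[OF wf cond(3)] using False q by simp
    qed
    then show ?thesis
      unfolding split_expr_def Let_def ev_if_expr[OF wf cond(1)] using False
      unfolding p_def q_def by simp
  qed
qed

lemma ev_rmq:
  assumes wf: "wf_state w st" and k: "ev st ek = k" "0 < k" "k \<le> m"
    and ac: "ev st ea = a" "ev st ec = c" "a < c" "c \<le> n"
  shows "range_argmin (pos k) a c (ev st (rmq_expr ek ea ec))"
proof -
  \<comment> \<open>The factor 1 matches \<open>ev_split\<close> with unit 1; its whole-block part
    is a second split with unit \<open>s\<close>.\<close>
  have "range_argmin (pos k) (a * 1) (c * 1) (ev st (rmq_expr ek ea ec))"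
    unfolding rmq_expr_def
  proof (rule ev_split[OF wf k _ _ ac(1-3)])
    show "range_argmin (pos k) ((x * s + i) * 1) ((x * s + j) * 1) (ev st (in_block_expr ek ex ei ej))"
      if "ev st ex = x" "ev st ei = i" "ev st ej = j" "i < j" "j \<le> s" "(x * s + j) * 1 \<le> n"
      for ex ei ej x i j
      using ev_in_block[OF k(1,3) that(1-5)] block_code(2)[OF that(4,5), of k x] that(6) by simp
    show "range_argmin (pos k) (x * (s * 1)) (y * (s * 1))
        (ev st (split_expr ek (in_superblock_expr ek) (superblock_range_expr ek) ex ey))"
      if "ev st ex = x" "ev st ey = y" "x < y" "y * (s * 1) \<le> n" for ex ey x y
      unfolding mult_1_right using that s_pos
      by (intro ev_split[OF wf k]) (auto intro: ev_in_superblock[OF k(1,3)] ev_superblock_range[OF wf k])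
  qed (use ac in auto)
  then show ?thesis by simp
qed

end

section \<open>The query program\<close>

fun loop_free :: "com \<Rightarrow> bool" where
  "loop_free (Seq c1 c2) \<longleftrightarrow> loop_free c1 \<and> loop_free c2"
| "loop_free (If e c1 c2) \<longleftrightarrow> loop_free c1 \<and> loop_free c2"
| "loop_free (While e c) \<longleftrightarrow> False"
| "loop_free _ \<longleftrightarrow> True"

fun max_time :: "com \<Rightarrow> nat" where
  "max_time Skip = 1"
| "max_time (Assign x e) = 1 + cost e"
| "max_time (Store a e) = 1 + cost a + cost e"
| "max_time (Emit e) = 1 + cost e"
| "max_time (Seq c1 c2) = max_time c1 + max_time c2"
| "max_time (If e c1 c2) = 1 + cost e + max_time c1 + max_time c2"
| "max_time (While e c) = 0"

context machine
begin

text \<open>A functional semantics, so that loop bodies can be evaluated by rewriting.\<close>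

fun final_state :: "com \<Rightarrow> state \<Rightarrow> state" where
  "final_state Skip st = st"
| "final_state (Assign x e) st = st\<lparr>regs := (regs st)(x := ev st e)\<rparr>"
| "final_state (Store a e) st = st\<lparr>mem := (mem st)(ev st a := ev st e)\<rparr>"
| "final_state (Emit e) st = st\<lparr>out := out st @ [ev st e]\<rparr>"
| "final_state (Seq c1 c2) st = final_state c2 (final_state c1 st)"
| "final_state (If e c1 c2) st = (if ev st e \<noteq> 0 then final_state c1 st else final_state c2 st)"
| "final_state (While e c) st = st"

lemma exec_loop_free:
  "loop_free c \<Longrightarrow> \<exists>t. exec w T D c st t (final_state c st) \<and> t \<le> max_time c"
proof (induction c arbitrary: st)
  case (Seq c1 c2)
  obtain t1 t2 where t: "exec w T D c1 st t1 (final_state c1 st)" "t1 \<le> max_time c1"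
    "exec w T D c2 (final_state c1 st) t2 (final_state c2 (final_state c1 st))" "t2 \<le> max_time c2"
    using Seq.IH(1)[of st] Seq.IH(2)[of "final_state c1 st"] Seq.prems by auto
  show ?case using exec.Seq[OF t(1,3)] t(2,4) by (intro exI[of _ "t1 + t2"]) simp
next
  case (If e c1 c2)
  obtain t1 t2 where t: "exec w T D c1 st t1 (final_state c1 st)" "t1 \<le> max_time c1"
    "exec w T D c2 st t2 (final_state c2 st)" "t2 \<le> max_time c2"
    using If.IH(1)[of st] If.IH(2)[of st] If.prems by auto
  show ?case
  proof (cases "ev st e = 0")
    case True
    then show ?thesis using exec.IfFalse[OF True t(3)] t(4)
      by (intro exI[of _ "1 + cost e + t2"]) simp
  next
    case False
    then show ?thesis using exec.IfTrue[OF False t(1)] t(2)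
      by (intro exI[of _ "1 + cost e + t1"]) simp
  qed
qed (auto intro: exec.intros)

lemma wf_final_state: "wf_state w st \<Longrightarrow> wf_state w (final_state c st)"
proof (induction c arbitrary: st)
  case (Assign x e)
  then show ?case using eval_less[of w st T D e] by (simp add: wf_state_def)
next
  case (Store a e)
  then show ?case using eval_less[of w st T D e] by (simp add: wf_state_def)
qed (auto simp: wf_state_def)

lemma ev_Reg: "ev st (Reg x) = regs st x"
  by (rule eval.simps)

end

text \<open>Registers 0 and 1 hold the query range, turned into a half-open one by \<open>init_com\<close>. Registers 2
  and 3 hold the bounds of the binary search. Register 5 holds the height of the stack of ranges
  in memory.\<close>

definition search_cond :: expr where
  "search_cond = Bin LT (Const 1) (Bin SUB (Reg 3) (Reg 2))"

definition search_body :: com where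
  "search_body = Seq (Assign 4 (Bin DIV (Bin ADD (Reg 2) (Reg 3)) (Const 2)))
     (If (Bin LT (kth_expr (Reg 4) (rmq_expr (Reg 4) (Reg 0) (Reg 1))) (Reg 1))
       (Assign 2 (Reg 4)) (Assign 3 (Reg 4)))"

text \<open>Empty ranges are never pushed; this keeps the height of the stack at most n. Entry
  number p occupies the cells 2 p and 2 p + 1.\<close>

definition push_com :: "nat \<Rightarrow> nat \<Rightarrow> com" where
  "push_com x y = If (Bin LT (Reg x) (Reg y))
     (Seq (Store (Bin ADD (Reg 5) (Reg 5)) (Reg x))
       (Seq (Store (Bin ADD (Bin ADD (Reg 5) (Reg 5)) (Const 1)) (Reg y))
         (Assign 5 (Bin ADD (Reg 5) (Const 1))))) Skip"

definition pop_com :: com where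
  "pop_com = Seq (Assign 5 (Bin SUB (Reg 5) (Const 1)))
     (Seq (Assign 6 (Mem (Bin ADD (Reg 5) (Reg 5))))
       (Assign 7 (Mem (Bin ADD (Bin ADD (Reg 5) (Reg 5)) (Const 1)))))"

definition enum_body :: com where
  "enum_body = Seq pop_com (Seq (Assign 8 (rmq_expr (Reg 2) (Reg 6) (Reg 7)))
     (If (Bin LT (kth_expr (Reg 2) (Reg 8)) (Reg 1))
       (Seq (Emit (Text (Reg 8)))
         (Seq (push_com 6 8)
           (Seq (Assign 6 (Bin ADD (Reg 8) (Const 1))) (push_com 6 7))))
       Skip))"

definition init_com :: com where
  "init_com = Seq (Assign 1 (Bin ADD (Reg 1) (Const 1)))
     (Seq (Assign 2 (Const 1)) (Assign 3 (Bin ADD (shared_expr 2 TextLen) (Const 1))))"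

definition start_com :: com where
  "start_com = Seq (Assign 5 (Const 0)) (push_com 0 1)"

definition query_com :: com where
  "query_com = Seq init_com (Seq (While search_cond search_body)
     (Seq start_com (While (Reg 5) enum_body)))"

lemma loop_free_push: "loop_free (push_com x y)"
  by (simp add: push_com_def)

lemma loop_free_query:
  "loop_free search_body" "loop_free enum_body" "loop_free init_com" "loop_free start_com"
  by (simp_all add: search_body_def enum_body_def init_com_def start_com_def pop_com_def
      loop_free_push)

text \<open>Covers both outcomes of \<open>push_com\<close> at height \<open>p\<close>, so that the
  induction treats empty subranges uniformly.\<close>

definition stacked :: "nat \<Rightarrow> nat \<Rightarrow> nat \<Rightarrow> state \<Rightarrow> bool" where
  "stacked p a c st \<longleftrightarrow>
     (if a < c then regs st 5 = p + 1 \<and> mem st (2 * p) = a \<and> mem st (2 * p + 1) = c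
      else regs st 5 = p)"

context mode_data
begin

lemma final_state_push:
  assumes "regs st 5 = p" "2 * p + 1 < 2 ^ w" "x \<noteq> 5" "y \<noteq> 5"
  defines "st' \<equiv> final_state (push_com x y) st"
  shows "stacked p (regs st x) (regs st y) st'"
    and "z \<noteq> 5 \<Longrightarrow> regs st' z = regs st z"
    and "regs st' 5 = p + of_bool (regs st x < regs st y)"
    and "i < 2 * p \<Longrightarrow> mem st' i = mem st i"
    and "out st' = out st"
proof -
  have one: "(1::nat) mod 2 ^ w = 1" using one_less by (rule mod_less)
  have p: "(p + p) mod 2 ^ w = 2 * p" "(2 * p + 1) mod 2 ^ w = 2 * p + 1" "(p + 1) mod 2 ^ w = p + 1"
    using assms(2) by (simp_all add: mult_2)
  have st': "st' = (if regs st x < regs st y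
      then st\<lparr>mem := (mem st)(2 * p := regs st x, 2 * p + 1 := regs st y), regs := (regs st)(5 := p + 1)\<rparr>
      else st)"
    using assms(1,3,4) one p by (simp add: st'_def push_com_def eval.simps apply_binop.simps)
  show "stacked p (regs st x) (regs st y) st'" "z \<noteq> 5 \<Longrightarrow> regs st' z = regs st z"
    "regs st' 5 = p + of_bool (regs st x < regs st y)"
    "i < 2 * p \<Longrightarrow> mem st' i = mem st i" "out st' = out st"
    unfolding st' stacked_def using assms(1) by auto
qed

lemma final_state_pop:
  assumes "stacked p a c st" "a < c" "2 * p + 1 < 2 ^ w"
  shows "final_state pop_com st = st\<lparr>regs := (regs st)(5 := p, 6 := a, 7 := c)\<rparr>"
proof -
  have one: "(1::nat) mod 2 ^ w = 1" using one_less by (rule mod_less)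
  have p: "(p + p) mod 2 ^ w = 2 * p" "(2 * p + 1) mod 2 ^ w = 2 * p + 1" "(p + 2 ^ w) mod 2 ^ w = p"
    using assms(3) by (simp_all add: mult_2)
  show ?thesis using assms(1,2) one p
    by (simp add: pop_com_def stacked_def eval.simps apply_binop.simps)
qed

text \<open>The lower bound is always an attained frequency and the upper bound an unattained one,
  so adjacent bounds give \<open>k\<close> and \<open>k + 1\<close>. The gap of at most
  \<open>2 ^ j\<close> halves in each round; \<open>j + 1\<close> also pays for the final
  test.\<close>

lemma search_correct:
  assumes "wf_state w st" "regs st 0 = l" "regs st 1 = e" "l < e" "e \<le> n"
    and "0 < regs st 2" "regs st 2 < regs st 3" "regs st 3 \<le> m + 1" "regs st 3 - regs st 2 \<le> 2 ^ j"
    and "\<exists>i\<in>{l..<e}. pos (regs st 2) i < e" "\<not> (\<exists>i\<in>{l..<e}. pos (regs st 3) i < e)"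
  shows "\<exists>st' t k. exec w (map code S) D (While search_cond search_body) st t st' \<and>
    t \<le> (j + 1) * (1 + cost search_cond + max_time search_body) \<and>
    wf_state w st' \<and> regs st' 0 = l \<and> regs st' 1 = e \<and> out st' = out st \<and>
    regs st' 2 = k \<and> 0 < k \<and> k \<le> m \<and>
    (\<exists>i\<in>{l..<e}. pos k i < e) \<and> \<not> (\<exists>i\<in>{l..<e}. pos (k + 1) i < e)"
  using assms
proof (induction j arbitrary: st)
  let ?K = "1 + cost search_cond + max_time search_body"
  have m_n: "m \<le> n" by (rule max_freq_le_length)
  have cond: "ev st search_cond = of_bool (1 < regs st 3 - regs st 2)"
    if "regs st 2 < regs st 3" "regs st 3 \<le> m + 1" for st
  proof -
    have "regs st 3 < 2 ^ w" using that(2) m_n by (intro small_less_w) linarith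
    then have "ev st (Bin SUB (Reg 3) (Reg 2)) = regs st 3 - regs st 2"
      using that(1) by (intro ev_SUB ev_Reg) auto
    then show ?thesis unfolding search_cond_def ev_LT using one_less by (simp add: ev_Const)
  qed
  {
    case 0
    then have eq: "regs st 3 = regs st 2 + 1" by simp
    then have "ev st search_cond = 0" using cond[of st] 0 by simp
    then have ex: "exec w (map code S) D (While search_cond search_body) st (1 + cost search_cond) st"
      by (rule exec.WhileFalse)
    have "regs st 2 \<le> m" using 0 by simp
    with 0 ex eq show ?case
      by (intro exI[of _ st] exI[of _ "1 + cost search_cond"] exI[of _ "regs st 2"]) simp
  next
    case (Suc j)
    show ?case
    proof (cases "1 < regs st 3 - regs st 2")
      case False
      then have eq: "regs st 3 = regs st 2 + 1" using Suc.prems by simp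
      then have "ev st search_cond = 0" using cond[of st] Suc.prems by simp
      then have ex: "exec w (map code S) D (While search_cond search_body) st (1 + cost search_cond) st"
        by (rule exec.WhileFalse)
      have "regs st 2 \<le> m" using Suc.prems eq by simp
      moreover have "1 + cost search_cond \<le> (Suc j + 1) * ?K" by simp
      ultimately show ?thesis using Suc.prems ex eq
        by (intro exI[of _ st] exI[of _ "1 + cost search_cond"] exI[of _ "regs st 2"]) simp
    next
      case True
      define lo hi mid where "lo = regs st 2" and "hi = regs st 3" and "mid = (lo + hi) div 2"
      have lohi: "0 < lo" "lo + 2 \<le> hi" "hi \<le> m + 1" "hi - lo \<le> 2 * 2 ^ j"
        using Suc.prems True by (simp_all add: lo_def hi_def)
      then have mid: "lo < mid" "mid < hi" "hi - mid \<le> 2 ^ j" "mid - lo \<le> 2 ^ j"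
        unfolding mid_def by linarith+
      have "hi < 2 ^ b" using lohi(3) m_n n6_b by linarith
      moreover have "lo + hi \<le> hi + hi" using lohi(2) by linarith
      moreover have "(2::nat) ^ b + 2 ^ b = 2 ^ (b + 1)" by simp
      moreover have "(2::nat) ^ (b + 1) \<le> 2 ^ w" using b_ge by (intro pow_w) simp
      ultimately have "lo + hi < 2 ^ w" by linarith
      moreover have "2 < (2::nat) ^ w" by (intro small_less_w) simp
      ultimately have evmid: "ev st (Bin DIV (Bin ADD (Reg 2) (Reg 3)) (Const 2)) = mid"
        unfolding mid_def lo_def hi_def by (intro ev_DIV ev_ADD ev_Reg ev_Const) auto
      define st1 where "st1 = st\<lparr>regs := (regs st)(4 := mid)\<rparr>"
      have wf1: "wf_state w st1"
        using wf_final_state[OF Suc.prems(1), of "Assign 4 (Bin DIV (Bin ADD (Reg 2) (Reg 3)) (Const 2))"]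
        by (simp add: st1_def evmid)
      have k: "ev st1 (Reg 4) = mid" "0 < mid" "mid \<le> m"
        using mid lohi by (simp_all add: st1_def ev_Reg)
      define q where "q = ev st1 (rmq_expr (Reg 4) (Reg 0) (Reg 1))"
      have q: "range_argmin (pos mid) l e q"
        unfolding q_def using Suc.prems(2-5)
        by (intro ev_rmq[OF wf1 k]) (simp_all add: st1_def ev_Reg)
      then have "q < n" using Suc.prems(5) by (auto simp: range_argmin_def)
      then have "ev st1 (kth_expr (Reg 4) (rmq_expr (Reg 4) (Reg 0) (Reg 1))) = pos mid q"
        by (intro ev_kth[OF wf1 k]) (simp_all add: q_def)
      then have test: "ev st1 (Bin LT (kth_expr (Reg 4) (rmq_expr (Reg 4) (Reg 0) (Reg 1))) (Reg 1)) =
          of_bool (pos mid q < e)"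
        unfolding ev_LT using Suc.prems(3) by (simp add: st1_def ev_Reg)
      have min: "pos mid q < e \<longleftrightarrow> (\<exists>i\<in>{l..<e}. pos mid i < e)"
      proof
        assume "pos mid q < e"
        then show "\<exists>i\<in>{l..<e}. pos mid i < e" using q by (auto simp: range_argmin_def)
      next
        assume "\<exists>i\<in>{l..<e}. pos mid i < e"
        then obtain i where "i \<in> {l..<e}" "pos mid i < e" by blast
        moreover from this(1) have "pos mid q \<le> pos mid i" using q unfolding range_argmin_def by blast
        ultimately show "pos mid q < e" by linarith
      qed
      define st2 where "st2 = final_state search_body st"
      have st2: "st2 = st1\<lparr>regs := (regs st1)((if pos mid q < e then 2 else 3) := mid)\<rparr>"
        unfolding st2_def search_body_def
        using test by (simp add: evmid flip: st1_def) (simp add: st1_def ev_Reg)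
      have wf2: "wf_state w st2" unfolding st2_def by (rule wf_final_state[OF Suc.prems(1)])
      obtain t1 where t1: "exec w (map code S) D search_body st t1 st2" "t1 \<le> max_time search_body"
        using exec_loop_free[OF loop_free_query(1), of st] unfolding st2_def by blast
      have "\<exists>st' t k. exec w (map code S) D (While search_cond search_body) st2 t st' \<and>
        t \<le> (j + 1) * ?K \<and>
        wf_state w st' \<and> regs st' 0 = l \<and> regs st' 1 = e \<and> out st' = out st2 \<and>
        regs st' 2 = k \<and> 0 < k \<and> k \<le> m \<and>
        (\<exists>i\<in>{l..<e}. pos k i < e) \<and> \<not> (\<exists>i\<in>{l..<e}. pos (k + 1) i < e)"
      proof (rule Suc.IH[OF wf2])
        show "regs st2 0 = l" "regs st2 1 = e" using Suc.prems(2,3) by (simp_all add: st2 st1_def)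
        show "l < e" "e \<le> n" by fact+
        have r2: "regs st2 2 = (if pos mid q < e then mid else lo)"
          "regs st2 3 = (if pos mid q < e then hi else mid)"
          by (simp_all add: st2 st1_def lo_def hi_def)
        show "0 < regs st2 2" "regs st2 2 < regs st2 3" "regs st2 3 \<le> m + 1"
          "regs st2 3 - regs st2 2 \<le> 2 ^ j"
          unfolding r2 using mid lohi by auto
        show "\<exists>i\<in>{l..<e}. pos (regs st2 2) i < e"
          unfolding r2 using min Suc.prems(10) by (simp add: lo_def)
        show "\<not> (\<exists>i\<in>{l..<e}. pos (regs st2 3) i < e)"
          unfolding r2 using min Suc.prems(11) by (simp add: hi_def)
      qed
      then obtain st' t k where st': "exec w (map code S) D (While search_cond search_body) st2 t st'"
        "t \<le> (j + 1) * ?K" "wf_state w st'" "regs st' 0 = l" "regs st' 1 = e" "out st' = out st2"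
        "regs st' 2 = k" "0 < k" "k \<le> m"
        "\<exists>i\<in>{l..<e}. pos k i < e" "\<not> (\<exists>i\<in>{l..<e}. pos (k + 1) i < e)"
        by blast
      have "ev st search_cond \<noteq> 0" using cond[of st] Suc.prems True by simp
      from exec.WhileTrue[OF this t1(1) st'(1)]
      have "exec w (map code S) D (While search_cond search_body) st (1 + cost search_cond + t1 + t) st'" .
      moreover have "1 + cost search_cond + t1 + t \<le> (Suc j + 1) * ?K"
        using t1(2) st'(2) by simp
      moreover have "out st' = out st" using st'(6) by (simp add: st2 st1_def)
      ultimately show ?thesis using st' by blast
    qed
  }
qed

text \<open>The loop does not halt when the top range is done, since entries below height
  \<open>p\<close> remain; hence the statement about an arbitrary continuation from
  \<open>st'\<close> and about unchanged cells below \<open>2 * p\<close>. Each hit pushes at most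
  two ranges, so there are at most \<open>2 * length xs + 1\<close> pops. The premise
  \<open>p + (c - a) \<le> n\<close> keeps the stack addresses within a word.\<close>

lemma enum_correct:
  fixes k e :: nat
  defines "H \<equiv> \<lambda>a c. {i \<in> {a..<c}. pos k i < e}"
  assumes k: "0 < k" "k \<le> m" and codes: "\<And>i. i < n \<Longrightarrow> code (S ! i) < 2 ^ w"
  assumes "wf_state w st" "stacked p a c st" "regs st 1 = e" "regs st 2 = k" "c \<le> n"
    and "p + (c - a) \<le> n"
  shows "\<exists>st' t xs.
    (\<forall>t2 st2. exec w (map code S) D (While (Reg 5) enum_body) st' t2 st2 \<longrightarrow>
       exec w (map code S) D (While (Reg 5) enum_body) st (t + t2) st2) \<and>
    wf_state w st' \<and> regs st' 5 = p \<and> regs st' 1 = e \<and> regs st' 2 = k \<and>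
    (\<forall>i<2 * p. mem st' i = mem st i) \<and>
    out st' = out st @ map (\<lambda>i. code (S ! i)) xs \<and> distinct xs \<and> set xs = H a c \<and>
    t \<le> (2 + max_time enum_body) * (2 * length xs + of_bool (a < c))"
  using assms(5-)
proof (induction "c - a" arbitrary: a c p st rule: less_induct)
  case less
  \<comment> \<open>The summand 2 pays for one loop test on \<open>Reg 5\<close>.\<close>
  let ?K = "2 + max_time enum_body"
  let ?W = "While (Reg 5) enum_body"
  show ?case
  proof (cases "a < c")
    case False
    then show ?thesis using less.prems
      by (intro exI[of _ st] exI[of _ 0] exI[of _ "[]"]) (auto simp: stacked_def H_def)
  next
    case True
    have pw: "2 * p + 3 < 2 ^ w"
      using less.prems(6) True n_b n_pos by (intro less_w) linarith
    define s1 where "s1 = st\<lparr>regs := (regs st)(5 := p, 6 := a, 7 := c)\<rparr>"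
    have s1: "final_state pop_com st = s1"
      unfolding s1_def using less.prems(2) True pw by (intro final_state_pop) auto
    have wf1: "wf_state w s1" using wf_final_state[OF less.prems(1), of pop_com] s1 by simp
    define q where "q = ev s1 (rmq_expr (Reg 2) (Reg 6) (Reg 7))"
    have q: "range_argmin (pos k) a c q"
      unfolding q_def using less.prems(4,5) True
      by (intro ev_rmq[OF wf1 _ k]) (simp_all add: s1_def ev_Reg)
    then have qac: "a \<le> q" "q < c" "q < n" and qmin: "\<And>i. a \<le> i \<Longrightarrow> i < c \<Longrightarrow> pos k q \<le> pos k i"
      using less.prems(5) by (auto simp: range_argmin_def)
    define s2 where "s2 = s1\<lparr>regs := (regs s1)(8 := q)\<rparr>"
    have s2: "final_state (Assign 8 (rmq_expr (Reg 2) (Reg 6) (Reg 7))) s1 = s2"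
      by (simp add: s2_def q_def)
    have wf2: "wf_state w s2" using wf_final_state[OF wf1] s2 by metis
    have regs2: "regs s2 1 = e" "regs s2 2 = k" "regs s2 5 = p" "regs s2 6 = a" "regs s2 7 = c" "regs s2 8 = q"
      using less.prems(3,4) by (simp_all add: s2_def s1_def)
    have "ev s2 (kth_expr (Reg 2) (Reg 8)) = pos k q"
      using qac by (intro ev_kth[OF wf2 _ k]) (simp_all add: ev_Reg regs2)
    then have test: "ev s2 (Bin LT (kth_expr (Reg 2) (Reg 8)) (Reg 1)) = of_bool (pos k q < e)"
      unfolding ev_LT ev_Reg regs2 by simp
    have "regs st 5 = p + 1" using less.prems(2) True by (simp add: stacked_def)
    then have nz: "ev st (Reg 5) \<noteq> 0" by (simp add: ev_Reg)
    obtain t1 where t1: "exec w (map code S) D enum_body st t1 (final_state enum_body st)"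
      "t1 \<le> max_time enum_body"
      using exec_loop_free[OF loop_free_query(2), of st] by blast
    have step: "exec w (map code S) D ?W st (2 + t1 + t2) st2"
      if "exec w (map code S) D ?W (final_state enum_body st) t2 st2" for t2 st2
      using exec.WhileTrue[OF nz t1(1) that] by simp
    show ?thesis
    proof (cases "pos k q < e")
      case False
      then have fin: "final_state enum_body st = s2"
        unfolding enum_body_def using test by (simp add: s1 s2 del: final_state.simps(2))
      have "H a c = {}" unfolding H_def using qmin False by fastforce
      moreover have "mem s2 = mem st" "out s2 = out st" by (simp_all add: s2_def s1_def)
      ultimately show ?thesis using step wf2 regs2 t1(2) True unfolding fin
        by (intro exI[of _ s2] exI[of _ "2 + t1"] exI[of _ "[]"]) simp
    next
      case hit: True
      define s3 where "s3 = s2\<lparr>out := out s2 @ [code (S ! q)]\<rparr>"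
      have "ev s2 (Text (Reg 8)) = code (S ! q)"
        using qac codes[of q] by (simp add: eval.simps text_word_def regs2)
      then have s3: "final_state (Emit (Text (Reg 8))) s2 = s3" by (simp add: s3_def)
      define s4 where "s4 = final_state (push_com 6 8) s3"
      define p1 where "p1 = p + of_bool (a < q)"
      have regs3: "regs s3 1 = e" "regs s3 2 = k" "regs s3 5 = p" "regs s3 6 = a" "regs s3 7 = c" "regs s3 8 = q"
        using regs2 by (simp_all add: s3_def)
      have push4: "stacked p a q s4" "\<And>z. z \<noteq> 5 \<Longrightarrow> regs s4 z = regs s3 z" "regs s4 5 = p1"
        "\<And>i. i < 2 * p \<Longrightarrow> mem s4 i = mem s3 i" "out s4 = out s3"
        using final_state_push[OF regs3(3), of 6 8] pw regs3 unfolding s4_def p1_def by simp_all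
      define s5 where "s5 = s4\<lparr>regs := (regs s4)(6 := q + 1)\<rparr>"
      have "ev s4 (Bin ADD (Reg 8) (Const 1)) = q + 1"
      proof (intro ev_ADD ev_Const one_less)
        show "ev s4 (Reg 8) = q" using push4(2)[of 8] regs3 by (simp add: ev_Reg)
        show "q + 1 < 2 ^ w" using qac by (intro small_less_w) linarith
      qed
      then have s5: "final_state (Assign 6 (Bin ADD (Reg 8) (Const 1))) s4 = s5" by (simp add: s5_def)
      have regs5: "regs s5 1 = e" "regs s5 2 = k" "regs s5 5 = p1" "regs s5 6 = q + 1" "regs s5 7 = c"
        using push4(2,3) regs3 by (simp_all add: s5_def)
      define s6 where "s6 = final_state (push_com 6 7) s5"
      have p1w: "2 * p1 + 1 < 2 ^ w" using pw by (simp add: p1_def)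
      have push6: "stacked p1 (q + 1) c s6" "\<And>z. z \<noteq> 5 \<Longrightarrow> regs s6 z = regs s5 z"
        "\<And>i. i < 2 * p1 \<Longrightarrow> mem s6 i = mem s5 i" "out s6 = out s5"
        using final_state_push[OF regs5(3) p1w, of 6 7] regs5 unfolding s6_def by simp_all
      have fin: "final_state enum_body st = s6"
        unfolding enum_body_def
        by (simp only: final_state.simps(5,6) s1 s2 s3 s4_def[symmetric] s5 s6_def[symmetric] test hit
            of_bool_eq one_neq_zero not_False_eq_True if_True)
      have wf6: "wf_state w s6" using wf_final_state[OF less.prems(1), of enum_body] fin by simp
      have "c - (q + 1) < c - a" using qac by simp
      \<comment> \<open>A left range waiting on the stack adds one entry and is nonempty, so its
        \<open>q - a\<close> positions pay for it.\<close>
      moreover have "p1 + (c - (q + 1)) \<le> n"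
      proof -
        have "of_bool (a < q) \<le> q - a" by (auto simp: Suc_le_eq)
        then show ?thesis using less.prems(6) qac unfolding p1_def by linarith
      qed
      ultimately obtain s7 t7 xs7 where
        s7: "\<And>t2 st2. exec w (map code S) D ?W s7 t2 st2 \<Longrightarrow> exec w (map code S) D ?W s6 (t7 + t2) st2"
        "wf_state w s7" "regs s7 5 = p1" "regs s7 1 = e" "regs s7 2 = k"
        "\<And>i. i < 2 * p1 \<Longrightarrow> mem s7 i = mem s6 i"
        "out s7 = out s6 @ map (\<lambda>i. code (S ! i)) xs7" "distinct xs7" "set xs7 = H (q + 1) c"
        "t7 \<le> ?K * (2 * length xs7 + of_bool (q + 1 < c))"
        using less.hyps[of c "q + 1" s6 p1] wf6 push6(1) push6(2)[of 1] push6(2)[of 2] regs5 less.prems(5)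
        by auto
      \<comment> \<open>The right range was pushed last and is handled first; its processing spares
        the entry of the left range, which is now on top.\<close>
      have st7: "stacked p a q s7"
      proof (cases "a < q")
        case True
        then have "mem s7 (2 * p) = mem s4 (2 * p)" "mem s7 (2 * p + 1) = mem s4 (2 * p + 1)"
          using s7(6) push6(3) by (simp_all add: p1_def s5_def)
        then show ?thesis using push4(1) s7(3) True by (simp add: stacked_def p1_def)
      next
        case False
        then show ?thesis using s7(3) by (simp add: stacked_def p1_def)
      qed
      have "q - a < c - a" "q \<le> n" "p + (q - a) \<le> n" using qac less.prems(6) by simp_all
      then obtain s8 t8 xs8 where
        s8: "\<And>t2 st2. exec w (map code S) D ?W s8 t2 st2 \<Longrightarrow> exec w (map code S) D ?W s7 (t8 + t2) st2"
        "wf_state w s8" "regs s8 5 = p" "regs s8 1 = e" "regs s8 2 = k"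
        "\<And>i. i < 2 * p \<Longrightarrow> mem s8 i = mem s7 i"
        "out s8 = out s7 @ map (\<lambda>i. code (S ! i)) xs8" "distinct xs8" "set xs8 = H a q"
        "t8 \<le> ?K * (2 * length xs8 + of_bool (a < q))"
        using less.hyps[of q a s7 p] s7 st7 by auto
      define xs where "xs = q # xs7 @ xs8"
      have steps: "\<forall>t2 st2. exec w (map code S) D ?W s8 t2 st2 \<longrightarrow>
          exec w (map code S) D ?W st (2 + t1 + t7 + t8 + t2) st2"
      proof (intro allI impI)
        fix t2 st2 assume "exec w (map code S) D ?W s8 t2 st2"
        from step[unfolded fin, OF s7(1)[OF s8(1)[OF this]]]
        show "exec w (map code S) D ?W st (2 + t1 + t7 + t8 + t2) st2" by (simp only: add.assoc)
      qed
      have mem: "\<forall>i<2 * p. mem s8 i = mem st i"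
        using s8(6) s7(6) push6(3) push4(4) by (simp add: p1_def s5_def s3_def s2_def s1_def)
      have "out s8 = out s3 @ map (\<lambda>i. code (S ! i)) xs7 @ map (\<lambda>i. code (S ! i)) xs8"
        unfolding s8(7) s7(7) push6(4) using push4(5) by (simp add: s5_def)
      then have out: "out s8 = out st @ map (\<lambda>i. code (S ! i)) xs"
        by (simp add: xs_def s3_def s2_def s1_def)
      have H_split: "H a c = insert q (H (q + 1) c \<union> H a q)"
        unfolding H_def using qac hit by auto
      have "q \<notin> H (q + 1) c" "q \<notin> H a q" "H (q + 1) c \<inter> H a q = {}" by (auto simp: H_def)
      then have dist: "distinct xs" using s7(8,9) s8(8,9) by (simp add: xs_def)
      have set: "set xs = H a c" using s7(9) s8(9) H_split by (simp add: xs_def)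
      have time: "2 + t1 + t7 + t8 \<le> ?K * (2 * length xs + of_bool (a < c))"
      proof -
        have "?K * (2 * length xs7 + of_bool (q + 1 < c)) \<le> ?K * (2 * length xs7 + 1)"
          "?K * (2 * length xs8 + of_bool (a < q)) \<le> ?K * (2 * length xs8 + 1)"
          by (intro mult_le_mono2, simp)+
        then have "t7 \<le> ?K * (2 * length xs7 + 1)" "t8 \<le> ?K * (2 * length xs8 + 1)"
          using s7(10) s8(10) by linarith+
        moreover have "?K * (2 * length xs + 1) =
            ?K + ?K * (2 * length xs7 + 1) + ?K * (2 * length xs8 + 1)"
          by (simp add: xs_def algebra_simps)
        ultimately show ?thesis using t1(2) True by simp
      qed
      show ?thesis
        by (rule exI[of _ s8], rule exI[of _ "2 + t1 + t7 + t8"], rule exI[of _ xs])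
          (intro conjI steps mem out dist set time s8(2-5))
    qed
  qed
qed

end

text \<open>With x the logarithm and c \<ge> 1 the output size, x + 2 \<le> 2 (x + c) and 2 c + 1
  \<le> 3 (x + c) give the factors 2 and 3. The last 2 is the failing test of the enumeration
  loop.\<close>

definition query_time :: nat where
  "query_time = max_time init_com + 2 * (1 + cost search_cond + max_time search_body) +
     max_time start_com + 3 * (2 + max_time enum_body) + 2"

text \<open>Makes \<open>b * b\<close> linear in the string length, as needed for the rounding up in
  the number of superblocks. The factor 36 gives equality at \<open>x = 0\<close>.\<close>

lemma exp_growth: "(x + 6) ^ 2 \<le> 36 * 2 ^ x" for x :: nat
proof (induction x)
  case (Suc x)
  have "(Suc x + 6) ^ 2 \<le> 2 * (x + 6) ^ 2" by (simp add: power2_eq_square algebra_simps)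
  then show ?case using Suc.IH by simp
qed simp

context mode_data
begin

lemma query_correct:
  assumes codes: "\<And>i. i < n \<Longrightarrow> code (S ! i) < 2 ^ w"
    and lr: "l \<le> r" "r < n" and start: "query_start w l r st"
  shows "\<exists>t st'. exec w (map code S) D query_com st t st' \<and> distinct (out st') \<and>
    set (out st') = code ` range_modes S l r \<and>
    t \<le> query_time * (floor_log m + card (range_modes S l r))"
proof -
  let ?E = "exec w (map code S) D"
  define e where "e = r + 1"
  have le: "l < e" "e \<le> n" using lr by (simp_all add: e_def)
  have regs0: "regs st 0 = l" "regs st 1 = r" "out st = []" "wf_state w st"
    using start by (auto simp: query_start_def wf_state_def)
  have m_le: "m \<le> n" by (rule max_freq_le_length)
  define st1 where "st1 = final_state init_com st"
  have one: "ev s' (Const 1) = 1" for s' by (intro ev_Const one_less)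
  have "ev s' (shared_expr 2 TextLen) = m" for s'
    using ev_shared[OF ev_n, where t = 2, of s'] n6_b m_le by (simp add: shared_def)
  then have ev3: "ev s' (Bin ADD (shared_expr 2 TextLen) (Const 1)) = m + 1" for s'
    using m_le by (intro ev_ADD one small_less_w) auto
  have ev1: "ev st (Bin ADD (Reg 1) (Const 1)) = e"
    unfolding e_def using regs0 lr by (intro ev_ADD one small_less_w) (auto simp: ev_Reg)
  have st1: "st1 = st\<lparr>regs := (regs st)(1 := e, 2 := 1, 3 := m + 1)\<rparr>"
    unfolding st1_def init_com_def final_state.simps ev1 ev3 one by simp
  have wf1: "wf_state w st1" unfolding st1_def by (rule wf_final_state[OF regs0(4)])
  obtain t1 where t1: "?E init_com st t1 st1" "t1 \<le> max_time init_com"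
    using exec_loop_free[OF loop_free_query(3), of st] unfolding st1_def by blast
  have pos_iff: "pos k i < e \<longleftrightarrow> k \<le> occ S i e (S ! i)" if "0 < k" "i < e" for k i
    using that le by (intro kth_occ_less_iff code_inj) auto
  have m_pos: "0 < m"
    using occ_first[of S l "S ! l" e] occ_le_max_freq[of l S e l] le by simp
  have "\<exists>st2 t k. ?E (While search_cond search_body) st1 t st2 \<and>
      t \<le> (floor_log m + 1 + 1) * (1 + cost search_cond + max_time search_body) \<and>
      wf_state w st2 \<and> regs st2 0 = l \<and> regs st2 1 = e \<and> out st2 = out st1 \<and>
      regs st2 2 = k \<and> 0 < k \<and> k \<le> m \<and>
      (\<exists>i\<in>{l..<e}. pos k i < e) \<and> \<not> (\<exists>i\<in>{l..<e}. pos (k + 1) i < e)"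
  proof (rule search_correct[OF wf1])
    show "regs st1 0 = l" "regs st1 1 = e" using regs0 by (simp_all add: st1)
    show "0 < regs st1 2" "regs st1 2 < regs st1 3" "regs st1 3 \<le> m + 1"
      using m_pos by (simp_all add: st1)
    show "regs st1 3 - regs st1 2 \<le> 2 ^ (floor_log m + 1)"
      using floor_log_exp2_ge[of m] by (simp add: st1)
    show "\<exists>i\<in>{l..<e}. pos (regs st1 2) i < e"
      using pos_iff[of 1 l] occ_first[of S l "S ! l" e] le by (intro bexI[of _ l]) (auto simp: st1)
    show "\<not> (\<exists>i\<in>{l..<e}. pos (regs st1 3) i < e)"
    proof
      assume "\<exists>i\<in>{l..<e}. pos (regs st1 3) i < e"
      then obtain i where "i \<in> {l..<e}" "pos (m + 1) i < e" by (auto simp: st1)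
      then show False using pos_iff[of "m + 1" i] occ_le_max_freq[of i S e i] le by simp
    qed
  qed (use le in simp_all)
  then obtain st2 t2 k where st2: "?E (While search_cond search_body) st1 t2 st2"
    "t2 \<le> (floor_log m + 1 + 1) * (1 + cost search_cond + max_time search_body)"
    "wf_state w st2" "regs st2 0 = l" "regs st2 1 = e" "out st2 = out st1"
    and k: "regs st2 2 = k" "0 < k" "k \<le> m" "\<exists>i\<in>{l..<e}. pos k i < e"
      "\<not> (\<exists>i\<in>{l..<e}. pos (k + 1) i < e)"
    by blast
  define st3 where "st3 = final_state start_com st2"
  define st2' where "st2' = st2\<lparr>regs := (regs st2)(5 := 0)\<rparr>"
  have st3_push: "st3 = final_state (push_com 0 1) st2'"
    unfolding st3_def start_com_def st2'_def by (simp add: ev_Const)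
  have regs2': "regs st2' 5 = 0" "regs st2' 0 = l" "regs st2' 1 = e" "regs st2' 2 = k"
    using st2 k by (simp_all add: st2'_def)
  have st3: "stacked 0 l e st3" "regs st3 1 = e" "regs st3 2 = k" "out st3 = []"
    using final_state_push[OF regs2'(1), of 0 1] one_less regs2' st2(6) regs0(3)
    by (simp_all add: st3_push st2'_def st1)
  have wf3: "wf_state w st3" unfolding st3_def by (rule wf_final_state[OF st2(3)])
  obtain t3 where t3: "?E start_com st2 t3 st3" "t3 \<le> max_time start_com"
    using exec_loop_free[OF loop_free_query(4), of st2] unfolding st3_def by blast
  define H where "H = {i \<in> {l..<e}. pos k i < e}"
  have "0 + (e - l) \<le> n" using le by simp
  from enum_correct[OF k(2,3) codes wf3 st3(1-3) le(2) this] obtain st4 t4 xs where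
    st4: "\<And>t' st'. ?E (While (Reg 5) enum_body) st4 t' st' \<Longrightarrow> ?E (While (Reg 5) enum_body) st3 (t4 + t') st'"
    "regs st4 5 = 0" "out st4 = out st3 @ map (\<lambda>i. code (S ! i)) xs"
    "distinct xs" "set xs = H" "t4 \<le> (2 + max_time enum_body) * (2 * length xs + of_bool (l < e))"
    unfolding H_def by blast
  have "ev st4 (Reg 5) = 0" using st4(2) by (simp add: ev_Reg)
  then have "?E (While (Reg 5) enum_body) st4 (1 + cost (Reg 5)) st4" by (rule exec.WhileFalse)
  from st4(1)[OF this] have loop: "?E (While (Reg 5) enum_body) st3 (t4 + 2) st4" by simp
  have H_eq: "H = {i \<in> {l..<Suc r}. k \<le> occ S i (Suc r) (S ! i)}"
    unfolding H_def using pos_iff[OF k(2)] by (auto simp: e_def)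
  have "H \<noteq> {}" using k(4) by (auto simp: H_def)
  moreover have "\<not> k + 1 \<le> occ S i (Suc r) (S ! i)" if "l \<le> i" "i \<le> r" for i
    using k(5) pos_iff[of "k + 1" i] that by (auto simp: e_def)
  ultimately have modes: "inj_on ((!) S) H" "(!) S ` H = range_modes S l r"
    using range_modes_eq[where k = k and S = S and l = l and r = r] k(2) unfolding H_eq by blast+
  have H_sub: "(!) S ` H \<subseteq> set S" using le by (auto simp: H_def)
  have "inj_on (\<lambda>i. code (S ! i)) H"
    using comp_inj_on[OF modes(1) inj_on_subset[OF code_inj H_sub]] by (simp add: comp_def)
  then have "distinct (out st4)" using st3(4) st4(3-5) by (simp add: distinct_map)
  moreover have "set (out st4) = code ` range_modes S l r"
    using st3(4) st4(3,5) by (simp add: image_image flip: modes(2))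
  moreover have "length xs = card (range_modes S l r)"
    using st4(4,5) card_image[OF modes(1)] modes(2) by (simp flip: distinct_card)
  moreover have "?E query_com st (t1 + (t2 + (t3 + (t4 + 2)))) st4"
    unfolding query_com_def by (intro exec.Seq[OF t1(1)] exec.Seq[OF st2(1)] exec.Seq[OF t3(1)] loop)
  moreover have "t1 + (t2 + (t3 + (t4 + 2))) \<le> query_time * (floor_log m + length xs)"
  proof -
    define x c where "x = floor_log m" and "c = length xs"
    define A B C E where "A = max_time init_com" and "B = 1 + cost search_cond + max_time search_body"
      and "C = max_time start_com" and "E = 2 + max_time enum_body"
    \<comment> \<open>A nonempty range has a mode, so the output absorbs all additive constants,
      even for \<open>m = 1\<close>, where the logarithm vanishes.\<close>
    have c: "1 \<le> c" using \<open>H \<noteq> {}\<close> st4(5) by (cases xs) (auto simp: c_def)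
    have "A * 1 \<le> A * (x + c)" using c by (intro mult_le_mono2) simp
    moreover have "(x + 2) * B \<le> (2 * (x + c)) * B" using c by (intro mult_le_mono1) simp
    moreover have "C + 2 \<le> (C + 2) * (x + c)" using c mult_le_mono2[of 1 "x + c" "C + 2"] by simp
    moreover have "E * (2 * c + 1) \<le> E * (3 * (x + c))" using c by (intro mult_le_mono2) simp
    moreover have "t1 \<le> A" "t2 \<le> (x + 2) * B" "t3 \<le> C" "t4 \<le> E * (2 * c + 1)"
      using t1(2) st2(2) t3(2) st4(6) le by (simp_all add: A_def B_def C_def E_def x_def c_def)
    moreover have "query_time * (x + c) =
        A * (x + c) + (2 * (x + c)) * B + (C + 2) * (x + c) + E * (3 * (x + c))"
      unfolding query_time_def A_def B_def C_def E_def by (simp add: algebra_simps)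
    ultimately show ?thesis unfolding x_def[symmetric] c_def[symmetric] by linarith
  qed
  ultimately show ?thesis by metis
qed

lemma answers:
  assumes "\<And>i. i < n \<Longrightarrow> code (S ! i) < 2 ^ w" "l \<le> r" "r < n"
  shows "answers_query query_com w code S D l r
    (real query_time * (log 2 (real m) + real (card (range_modes S l r))))"
  unfolding answers_query_def
proof (intro allI impI)
  fix st assume "query_start w l r st"
  from query_correct[OF assms this] obtain t st' where
    st': "exec w (map code S) D query_com st t st'" "distinct (out st')"
    "set (out st') = code ` range_modes S l r"
    and t: "t \<le> query_time * (floor_log m + card (range_modes S l r))"
    by blast
  have "0 < occ S l (Suc r) (S ! l)" using assms(2) by (intro occ_first) auto
  then have "0 < m" using occ_le_max_freq[of l S "Suc r" l] assms(2,3) by simp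
  then have "real (floor_log m) \<le> log 2 (real m)"
    by (simp add: floor_log_altdef)
  then have "real query_time * (real (floor_log m) + real (card (range_modes S l r))) \<le>
      real query_time * (log 2 (real m) + real (card (range_modes S l r)))"
    by (intro mult_left_mono) auto
  moreover have "real t \<le> real query_time * (real (floor_log m) + real (card (range_modes S l r)))"
    using t by (simp flip: of_nat_add of_nat_mult)
  ultimately show "\<exists>t st'. exec w (map code S) D query_com st t st' \<and> distinct (out st') \<and>
      set (out st') = code ` range_modes S l r \<and>
      real t \<le> real query_time * (log 2 (real m) + real (card (range_modes S l r)))"
    using st' by (intro exI[of _ t] exI[of _ st']) simp
qed

text \<open>Here 2291 = 7 + 1920 + 364: the header of at most 7 n bits, the linear part of the
  shared tables, and the levels, all charged to \<open>n * m\<close>, which is at least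
  \<open>n\<close>.\<close>

lemma length_D_le: "length D \<le> 2291 * (n * m + n * floor_log n)"
proof -
  define x where "x = floor_log n"
  have x_le: "2 ^ x \<le> n" unfolding x_def using n_pos by (rule floor_log_exp2_le)
  have b: "b = x + 6" by (simp add: b_def x_def)
  have m_pos: "0 < m"
    using occ_first[of S 0 "S ! 0" n] occ_le_max_freq[of 0 S n 0] n_pos by simp
  then have nm: "n * 1 \<le> n * m" by (intro mult_le_mono2) simp
  have b6: "b \<le> 6 * n" using x_le less_exp[of x] unfolding b by linarith
  \<comment> \<open>Tight at \<open>b = 8\<close>, where \<open>s = 1\<close>.\<close>
  have bs: "b \<le> s * 8" using b_ge unfolding s_def by presburger
  have N1b: "N1 * b \<le> 14 * n"
  proof -
    have "n div s * b \<le> n div s * (s * 8)" by (intro mult_le_mono2 bs)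
    also have "\<dots> = 8 * (n div s * s)" by simp
    also have "\<dots> \<le> 8 * n" by simp
    finally show ?thesis using b6 unfolding N1_def add_mult_distrib by linarith
  qed
  have "N1 div s \<le> N1" by simp
  then have "N2 * b \<le> (N1 + 1) * b" unfolding N2_def by (intro mult_le_mono1) simp
  then have N2b: "N2 * b \<le> 20 * n" using N1b b6 unfolding add_mult_distrib by linarith
  have bb: "b * b \<le> 36 * n"
    using exp_growth[of x] x_le unfolding b power2_eq_square by linarith
  \<comment> \<open>The critical term: \<open>b\<close> rows of \<open>b\<close>-bit entries, where
    the two divisions by \<open>s\<close> cancel both factors \<open>b\<close>.\<close>
  have N2bb: "b * N2 * b \<le> 148 * n"
  proof -
    have "N1 div s * b \<le> N1 div s * (s * 8)" by (intro mult_le_mono2 bs)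
    also have "\<dots> = 8 * (N1 div s * s)" by simp
    also have "\<dots> \<le> 8 * N1" by simp
    finally have "N1 div s * b * b \<le> 8 * N1 * b" by (rule mult_le_mono1)
    also have "\<dots> \<le> 112 * n" using N1b by simp
    finally have "N1 div s * b * b + b * b \<le> 148 * n" using bb by linarith
    moreover have "b * N2 * b = N1 div s * b * b + b * b" unfolding N2_def by (simp add: algebra_simps)
    ultimately show ?thesis by simp
  qed
  have Gb: "G * b \<le> 182 * n"
    using N1b N2b N2bb unfolding G_def add_mult_distrib by linarith
  have "(m + 1) * (G * b) \<le> (2 * m) * (182 * n)" using m_pos by (intro mult_le_mono Gb) simp
  then have levels: "(m + 1) * G * b \<le> 364 * (n * m)" by (simp add: algebra_simps)
  have "2 ^ b \<le> 64 * n" using x_le unfolding b power_add by simp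
  then have "5 * 2 ^ b * b \<le> 5 * (64 * n) * b" by (intro mult_le_mono1 mult_le_mono2)
  then have tables: "5 * 2 ^ b * b \<le> 320 * (n * x) + 1920 * n" unfolding b by (simp add: algebra_simps)
  have "length D = n + 6 + (5 * 2 ^ b * b + (m + 1) * G * b)"
    unfolding length_D M_def add_mult_distrib ..
  then show ?thesis using levels tables nm n_pos unfolding x_def[symmetric] distrib_left by linarith
qed

end

theorem theorem19:
  shows "\<exists>(Q :: com) (K :: real) (C\<^sub>s :: real) (C\<^sub>t :: real).
    \<forall>(\<Sigma> :: 'a set) (code :: 'a \<Rightarrow> nat) (S :: 'a list) (w :: nat) (n :: nat) (m :: nat).
      finite \<Sigma> \<and> bij_betw code \<Sigma> {0..<card \<Sigma>} \<and> set S \<subseteq> \<Sigma> \<and>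
      n = length S \<and> m = max_freq S \<and>
      card \<Sigma> \<le> 2 ^ w \<and> K * log 2 (real n + 2) \<le> real w \<longrightarrow>
      (\<exists>D :: bool list.
         real (length D) \<le> C\<^sub>s * (real n * real m + real n * log 2 (real n)) \<and>
         (\<forall>l r. l \<le> r \<and> r < n \<longrightarrow>
            answers_query Q w code S D l r
              (C\<^sub>t * (log 2 (real m) + real (card (range_modes S l r))))))"
proof (rule exI[of _ query_com], rule exI[of _ 70], rule exI[of _ 2291],
    rule exI[of _ "real query_time"], intro allI impI, elim conjE)
  fix \<Sigma> :: "'a set" and code S w n m
  assume bij: "bij_betw code \<Sigma> {0..<card \<Sigma>}" and S: "set S \<subseteq> \<Sigma>" "n = length S" "m = max_freq S"
    and w: "card \<Sigma> \<le> 2 ^ w" "70 * log 2 (real n + 2) \<le> real w"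
  show "\<exists>D :: bool list.
     real (length D) \<le> 2291 * (real n * real m + real n * log 2 (real n)) \<and>
     (\<forall>l r. l \<le> r \<and> r < n \<longrightarrow>
        answers_query query_com w code S D l r
          (real query_time * (log 2 (real m) + real (card (range_modes S l r)))))"
  proof (cases "S = []")
    case True
    \<comment> \<open>The empty string admits no query, and its space bound is 0.\<close>
    then show ?thesis using S by (intro exI[of _ "[]"]) simp
  next
    case False
    then have n: "0 < n" using S by simp
    have fl: "real (floor_log n) \<le> log 2 (real n)" using n by (simp add: floor_log_altdef)
    define x where "x = log 2 (real n + 2)"
    have "log 2 (real n) \<le> x" using n by (simp add: x_def)
    then have "real (floor_log n) \<le> x" using fl by simp
    \<comment> \<open>Pays for the constant 60 in \<open>10 * (floor_log n + 6)\<close>; hence 70 =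
      10 + 60.\<close>
    moreover have "1 \<le> x" by (simp add: x_def le_log_iff)
    moreover have "70 * x \<le> real w" using w(2) by (simp add: x_def)
    ultimately have "10 * real (floor_log n) + 60 \<le> real w" by linarith
    then have "real (10 * floor_log n + 60) \<le> real w" by simp
    then have "10 * (floor_log (length S) + 6) \<le> w" unfolding of_nat_le_iff S(2) by simp
    moreover have "inj_on code (set S)"
      using bij S(1) by (auto simp: bij_betw_def intro: inj_on_subset)
    ultimately interpret mode_data S code w using False by unfold_locales
    have codes: "code (S ! i) < 2 ^ w" if "i < length S" for i
    proof -
      have "S ! i \<in> \<Sigma>" using that S(1) by auto
      then have "code (S ! i) < card \<Sigma>" using bij by (auto simp: bij_betw_def)
      then show ?thesis using w(1) by linarith
    qed
    have "real (length D) \<le> real (2291 * (n * m + n * floor_log n))"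
      using length_D_le unfolding S(2,3) of_nat_le_iff .
    also have "\<dots> \<le> 2291 * (real n * real m + real n * log 2 (real n))"
      using mult_left_mono[OF fl, of "real n"] by simp
    finally have "real (length D) \<le> 2291 * (real n * real m + real n * log 2 (real n))" .
    then show ?thesis using answers codes S(2,3) by blast
  qed
qed

end
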